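(* Let $\mathbf{x},\mathbf{y},\mathbf{z} \in (\mathbf{R}/\mathbf{Z})^2 \setminus \{\mathbf{0}\}$ with $\mathbf{x}+\mathbf{y}+\mathbf{z}=\mathbf{0}$. Then, as functions of $\tau$ in the upper half-plane $\mathcal{H}$, \[ E^{(1)}_{\mathbf z} E^{(2)}_{\mathbf y} - E^{(1)}_{\mathbf y} E^{(2)}_{\mathbf x} - E^{(1)}_{\mathbf z} E^{(2)}_{\mathbf x} + E^{(1)}_{\mathbf y} E^{(2)}_{\mathbf z} = E^{(3)}_{\mathbf x} - \tfrac12 E^{(3)}_{\mathbf y} - \tfrac12 E^{(3)}_{\mathbf z}. \]
   Context: For $\tau \in \mathcal{H}$ let $L=\mathbf{Z}+\tau\mathbf{Z}$ and $A=\operatorname{Im}(\tau)/\pi$. For an integer $a\ge 1$ and $x_0\in\mathbf{C}$, the Kronecker series $K_a(0,x_0,s;\tau)=\sum_{w\in L\setminus\{0\}} \exp\big(A^{-1}(w\overline{x_0}-\overline{w}x_0)\big)\,\overline{w}^a |w|^{-2s}$ converges for $\operatorname{Re}(s)>1+a/2$ and extends to an entire function of $s$. For an integer $k\ge1$ and $\mathbf{x}=(x_1,x_2)\in(\mathbf{R}/\mathbf{Z})^2$, define $E^{(k)}_{\mathbf x}(\tau) = -\frac{(k-1)!}{(-2\pi i)^k} K_k(0,x_1\tau+x_2,k;\tau)$ (value at $s=k$ of the continuation). *)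

theory Defs
  imports "HOL-Complex_Analysis.Complex_Analysis"
begin

quotient_type real_mod_int = real / "\<lambda>x y :: real. x - y \<in> \<int>"
proof (rule equivpI)
  show "reflp (\<lambda>x y :: real. x - y \<in> \<int>)"
    by (simp add: reflp_def)
  show "symp (\<lambda>x y :: real. x - y \<in> \<int>)"
    by (rule sympI) (metis Ints_minus minus_diff_eq)
  show "transp (\<lambda>x y :: real. x - y \<in> \<int>)"
  proof (rule transpI)
    fix x y z :: real
    assume "x - y \<in> \<int>" "y - z \<in> \<int>"
    then have "(x - y) + (y - z) \<in> \<int>" by (rule Ints_add)
    then show "x - z \<in> \<int>" by simp
  qed
qed

instantiation real_mod_int :: ab_group_add
begin

lift_definition zero_real_mod_int :: real_mod_int is "0" .

lift_definition plus_real_mod_int :: "real_mod_int \<Rightarrow> real_mod_int \<Rightarrow> real_mod_int" is "(+)"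
proof -
  fix a b c d :: real
  assume "a - b \<in> \<int>" "c - d \<in> \<int>"
  then have "(a - b) + (c - d) \<in> \<int>" by (rule Ints_add)
  then show "a + c - (b + d) \<in> \<int>" by (simp add: algebra_simps)
qed

lift_definition uminus_real_mod_int :: "real_mod_int \<Rightarrow> real_mod_int" is "uminus"
proof -
  fix a b :: real
  assume "a - b \<in> \<int>"
  then have "- (a - b) \<in> \<int>" by (rule Ints_minus)
  then show "- a - - b \<in> \<int>" by simp
qed

lift_definition minus_real_mod_int :: "real_mod_int \<Rightarrow> real_mod_int \<Rightarrow> real_mod_int" is "(-)"
proof -
  fix a b c d :: real
  assume "a - b \<in> \<int>" "c - d \<in> \<int>"
  then have "(a - b) - (c - d) \<in> \<int>" by (rule Ints_diff)
  then show "a - c - (b - d) \<in> \<int>" by (simp add: algebra_simps)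
qed

instance
  by standard (transfer; simp)+

end

definition period_lattice :: "complex \<Rightarrow> complex set" where
  "period_lattice \<tau> = {of_int m + of_int n * \<tau> | m n :: int. True}"

definition lattice_char :: "complex \<Rightarrow> complex \<Rightarrow> complex \<Rightarrow> complex" where
  "lattice_char \<tau> x0 w = exp ((w * cnj x0 - cnj w * x0) / of_real (Im \<tau> / pi))"

definition kronecker_series :: "nat \<Rightarrow> complex \<Rightarrow> complex \<Rightarrow> complex \<Rightarrow> complex" where
  "kronecker_series a x0 s \<tau> =
     (\<Sum>\<^sub>\<infinity>w\<in>period_lattice \<tau> - {0}. lattice_char \<tau> x0 w * cnj w ^ a * of_real (cmod w) powr (- 2 * s))"

text \<open>\<open>kronecker_K a x0 s \<tau>\<close> is $K_a(0, x_0, s; \tau)$ for arbitrary \<open>s\<close>: the value at \<open>s\<close> of the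
  entire continuation of the series, which is unique when it exists
  (see \<open>kronecker_K_eqI\<close>).\<close>

definition kronecker_K :: "nat \<Rightarrow> complex \<Rightarrow> complex \<Rightarrow> complex \<Rightarrow> complex" where
  "kronecker_K a x0 s \<tau> =
     (THE F. F holomorphic_on UNIV \<and>
        (\<forall>s. Re s > 1 + real a / 2 \<longrightarrow> F s = kronecker_series a x0 s \<tau>)) s"

lemma kronecker_K_eqI:
  assumes "F holomorphic_on UNIV"
    and "\<And>s. Re s > 1 + real a / 2 \<Longrightarrow> F s = kronecker_series a x0 s \<tau>"
  shows "kronecker_K a x0 s \<tau> = F s"
proof -
  have unique: "G = F" if "G holomorphic_on UNIV"
    and G: "\<forall>s. Re s > 1 + real a / 2 \<longrightarrow> G s = kronecker_series a x0 s \<tau>" for G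
  proof
    fix z
    let ?H = "{s. Re s > 1 + real a / 2}"
    have "complex_of_real (2 + real a / 2) \<in> ?H"
      by simp
    then have ne: "?H \<noteq> {}" by blast
    have eq: "G s = F s" if "s \<in> ?H" for s
      using that G assms(2) by simp
    show "G z = F z"
      by (rule analytic_continuation_open[OF open_halfspace_Re_gt open_UNIV ne connected_UNIV
            subset_UNIV \<open>G holomorphic_on UNIV\<close> assms(1) eq UNIV_I])
  qed
  have "(THE F. F holomorphic_on UNIV \<and>
      (\<forall>s. Re s > 1 + real a / 2 \<longrightarrow> F s = kronecker_series a x0 s \<tau>)) = F"
    by (intro the_equality unique conjI allI impI) (use assms in blast)+
  then show ?thesis by (simp add: kronecker_K_def)
qed

lemma lattice_char_shift:
  assumes "w \<in> period_lattice \<tau>" "x1 - y1 \<in> \<int>" "x2 - y2 \<in> \<int>"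
  shows "lattice_char \<tau> (of_real x1 * \<tau> + of_real x2) w =
         lattice_char \<tau> (of_real y1 * \<tau> + of_real y2) w"
proof (cases "Im \<tau> = 0")
  case False
  obtain m n :: int where w: "w = of_int m + of_int n * \<tau>"
    using assms(1) by (auto simp: period_lattice_def)
  obtain p q :: int where pq: "x1 - y1 = of_int p" "x2 - y2 = of_int q"
    using assms(2,3) by (auto elim!: Ints_cases)
  have x: "x1 = y1 + of_int p" "x2 = y2 + of_int q"
    using pq by auto
  have tau: "\<tau> - cnj \<tau> = 2 * of_real (Im \<tau>) * \<i>"
    by (simp add: complex_eq_iff)
  have "w * cnj (of_real x1 * \<tau> + of_real x2) - cnj w * (of_real x1 * \<tau> + of_real x2) =
     w * cnj (of_real y1 * \<tau> + of_real y2) - cnj w * (of_real y1 * \<tau> + of_real y2)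
       + of_int (n * q - m * p) * (\<tau> - cnj \<tau>)"
    by (simp add: w x) (simp add: algebra_simps)
  moreover have "of_int (n * q - m * p) * (\<tau> - cnj \<tau>) / of_real (Im \<tau> / pi) =
     of_real (of_int (2 * (n * q - m * p)) * pi) * \<i>"
    unfolding tau using False by simp
  ultimately show ?thesis
    unfolding lattice_char_def exp_eq
    by (intro exI[of _ "n * q - m * p"]) (simp only: add_divide_distrib)
qed (simp add: lattice_char_def)

lemma kronecker_K_shift:
  assumes "x1 - y1 \<in> \<int>" "x2 - y2 \<in> \<int>"
  shows "kronecker_K a (of_real x1 * \<tau> + of_real x2) s \<tau> =
         kronecker_K a (of_real y1 * \<tau> + of_real y2) s \<tau>"
proof -
  have "kronecker_series a (of_real x1 * \<tau> + of_real x2) s \<tau> =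
        kronecker_series a (of_real y1 * \<tau> + of_real y2) s \<tau>" for s
    unfolding kronecker_series_def
    by (intro infsum_cong) (use lattice_char_shift[OF _ assms] in auto)
  then show ?thesis unfolding kronecker_K_def by presburger
qed

lift_definition eisenstein_E_aux ::
    "nat \<Rightarrow> real_mod_int \<Rightarrow> real_mod_int \<Rightarrow> complex \<Rightarrow> complex" is
  "\<lambda>k (x1::real) (x2::real) \<tau>. - (fact (k - 1) / (- 2 * of_real pi * \<i>) ^ k
     * kronecker_K k (of_real x1 * \<tau> + of_real x2) (of_nat k) \<tau>)"
  by (intro ext) (metis kronecker_K_shift)

definition eisenstein_E :: "nat \<Rightarrow> real_mod_int \<times> real_mod_int \<Rightarrow> complex \<Rightarrow> complex" where
  "eisenstein_E k x \<tau> = eisenstein_E_aux k (fst x) (snd x) \<tau>"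

end

(* For a nontrivial character psi of L and h in L with psi h ~= 1, summation by parts in the
   direction h replaces f by its N-th difference, which decays N orders faster: this continues
   the Kronecker series to all s without Poisson summation, and the value e_k at s = k is the
   twisted sum of the second differences of w^(-k).  The same device defines
   F(u) = sum of psi(w) / (w + u), which has the multiplier 1 / psi, simple poles on L, and the
   expansion 1/u + e_1 - u e_2 + u^2 e_3 + O(u^3).  For characters y, z with y z nontrivial,
     F_y F_z + F_yz' - (e_1(y) + e_1(z)) F_yz
   has no poles and a nontrivial unitary multiplier, so it vanishes by Liouville's theorem.  Its
   coefficient at u, together with e_k(-x) = (-1)^k e_k(x), is the asserted relation. *)


theory Submission
  imports Defs
begin

section \<open>Iterated finite differences\<close>

text \<open>The sums of \<psi>(w)/(w + u), and of \<psi>(w)/w^k for k = 1, 2, do not converge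
  absolutely, and any order of summation would have to be reconciled with shifts by L. The
  differenced sums converge absolutely, so they can be reindexed freely; one difference multiplies a
  twisted sum by 1/\<psi>(h) - 1, and dividing by a power of this number makes all levels agree. The
  Kronecker terms are not holomorphic in w, whereas the decay of differences comes from Cauchy
  estimates. Only values on the line w + th matter, and there the terms are real analytic in t and
  extend to complex t. The auxiliary function is dictated by principal parts: that of F_y F_z is
  u^(-2) + (e_1(y) + e_1(z)) u^(-1), the derivative F_yz' cancels the double pole and the multiple
  of F_yz the residue, and all three have the same multiplier. As x = -(y + z), it is x \<noteq> 0
  that makes the product character nontrivial.\<close>

definition fdiff :: "complex \<Rightarrow> (complex \<Rightarrow> complex) \<Rightarrow> complex \<Rightarrow> complex" where
  "fdiff h g = (\<lambda>z. g (z + h) - g z)"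

lemma fdiff_funpow_Suc:
  "(fdiff h ^^ Suc n) g w = (fdiff h ^^ n) g (w + h) - (fdiff h ^^ n) g w"
  by (simp add: fdiff_def)

lemma fdiff_funpow_add:
  "(fdiff h ^^ n) (\<lambda>z. f z + g z) w = (fdiff h ^^ n) f w + (fdiff h ^^ n) g w"
  by (induction n arbitrary: w) (simp_all only: fdiff_funpow_Suc funpow_0, simp_all)

lemma fdiff_funpow_cmult:
  "(fdiff h ^^ n) (\<lambda>z. c * g z) w = c * (fdiff h ^^ n) g w"
  by (induction n arbitrary: w) (simp_all only: fdiff_funpow_Suc funpow_0, simp_all add: algebra_simps)

lemma fdiff_funpow_shift:
  "(fdiff h ^^ n) (\<lambda>z. g (z + v)) w = (fdiff h ^^ n) g (w + v)"
  by (induction n arbitrary: w) (simp_all only: fdiff_funpow_Suc funpow_0, simp_all add: algebra_simps)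

text \<open>Only the n + 1 values along the progression enter, so a function that is not holomorphic
  may be replaced by a holomorphic one that interpolates it at 0, ..., n with step 1.\<close>

lemma fdiff_funpow_eq:
  assumes "\<And>j. j \<le> n \<Longrightarrow> g (w + of_nat j * h) = f (c + of_nat j * k)"
  shows "(fdiff h ^^ n) g w = (fdiff k ^^ n) f c"
  using assms
proof (induction n arbitrary: w c)
  case (Suc n)
  have "(fdiff h ^^ n) g (w + h) = (fdiff k ^^ n) f (c + k)"
  proof (rule Suc.IH)
    show "g (w + h + of_nat j * h) = f (c + k + of_nat j * k)" if "j \<le> n" for j
      using Suc.prems[of "Suc j"] that by (simp add: algebra_simps)
  qed
  moreover have "(fdiff h ^^ n) g w = (fdiff k ^^ n) f c"
    using Suc by simp
  ultimately show ?case
    by (simp only: fdiff_funpow_Suc)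
qed simp

lemma holomorphic_fdiff_funpow:
  assumes "\<And>j. j \<le> n \<Longrightarrow> (\<lambda>u. g u (w + of_nat j * h)) holomorphic_on S"
  shows "(\<lambda>u. (fdiff h ^^ n) (g u) w) holomorphic_on S"
  using assms
proof (induction n arbitrary: w)
  case (Suc n)
  have "(\<lambda>u. (fdiff h ^^ n) (g u) (w + h)) holomorphic_on S"
  proof (rule Suc.IH)
    show "(\<lambda>u. g u (w + h + of_nat j * h)) holomorphic_on S" if "j \<le> n" for j
      using Suc.prems[of "Suc j"] that by (simp add: algebra_simps)
  qed
  moreover have "(\<lambda>u. (fdiff h ^^ n) (g u) w) holomorphic_on S"
    using Suc by simp
  ultimately show ?case
    by (simp only: fdiff_funpow_Suc) (intro holomorphic_on_diff)
qed simp

text \<open>One difference costs a Cauchy estimate, which shrinks the disc by r and bounds the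
  derivative by B / r, and a segment from t to t + 1, which shrinks the disc by 1. After n
  differences the radius has dropped by n(1 + r) and the bound has been divided by r^n.\<close>

lemma norm_fdiff_funpow_le_aux:
  assumes "g holomorphic_on ball 0 R" "\<And>t. t \<in> ball 0 R \<Longrightarrow> norm (g t) \<le> B"
    and "r > 0" "real n * (1 + r) < R"
  shows "norm ((fdiff 1 ^^ n) g 0) \<le> B / r ^ n"
  using assms
proof (induction n arbitrary: g R B)
  case (Suc n)
  note hol = Suc.prems(1) and B = Suc.prems(2)
  let ?R = "R - 1 - r"
  have nr: "0 \<le> real n * (1 + r)"
    using \<open>r > 0\<close> by simp
  then have R: "1 + r < R"
    using Suc.prems(4) by (simp add: algebra_simps)
  have sub: "ball 0 (R - r) \<subseteq> ball (0 :: complex) R"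
    using \<open>r > 0\<close> by (auto simp: subset_iff)
  have deriv_le: "norm (deriv g z) \<le> B / r" if z: "z \<in> ball 0 (R - r)" for z
  proof -
    have sub': "cball z r \<subseteq> ball 0 R"
    proof
      fix t assume "t \<in> cball z r"
      then have "norm t \<le> norm z + r"
        using norm_triangle_ineq2[of t z] by (auto simp: dist_norm norm_minus_commute)
      then show "t \<in> ball 0 R" using z by simp
    qed
    have "norm ((deriv ^^ 1) g z) \<le> fact 1 * B / r ^ 1"
    proof (rule Cauchy_inequality)
      show "g holomorphic_on ball z r"
        using sub' ball_subset_cball by (meson hol holomorphic_on_subset order.trans)
      show "continuous_on (cball z r) g"
        using sub' hol by (meson continuous_on_subset holomorphic_on_imp_continuous_on)
      show "norm (g t) \<le> B" if "norm (z - t) = r" for t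
        using B sub' that by (auto simp: subset_iff dist_norm)
    qed (use \<open>r > 0\<close> in auto)
    then show ?thesis by simp
  qed
  have diff_le: "norm (fdiff 1 g t) \<le> B / r" if t: "t \<in> ball 0 ?R" for t
  proof -
    have "norm (t + 1) \<le> norm t + 1"
      using norm_triangle_ineq[of t 1] by simp
    then have "norm (g (t + 1) - g t) \<le> B / r * norm (t + 1 - t)"
      using t
      by (intro field_differentiable_bound[where S = "ball 0 (R - r)" and f' = "deriv g"] deriv_le
          holomorphic_derivI[OF hol, THEN DERIV_subset]) (use sub in auto)
    then show ?thesis by (simp add: fdiff_def)
  qed
  have "norm ((fdiff 1 ^^ n) (fdiff 1 g) 0) \<le> B / r / r ^ n"
  proof (rule Suc.IH)
    have "(\<lambda>t. g (t + 1)) holomorphic_on ball 0 ?R"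
    proof (rule holomorphic_on_compose_gen[OF _ hol, of "\<lambda>t. t + 1", unfolded o_def])
      show "(\<lambda>t. t + 1) ` ball 0 ?R \<subseteq> ball (0 :: complex) R"
      proof
        fix s :: complex assume "s \<in> (\<lambda>t. t + 1) ` ball 0 ?R"
        then obtain t where "s = t + 1" "norm t < ?R" by auto
        then show "s \<in> ball 0 R"
          using norm_triangle_ineq[of t 1] \<open>r > 0\<close> by simp
      qed
    qed (intro holomorphic_intros)
    moreover have "g holomorphic_on ball 0 ?R"
      by (rule holomorphic_on_subset[OF hol]) (use \<open>r > 0\<close> in \<open>auto simp: subset_iff\<close>)
    ultimately show "fdiff 1 g holomorphic_on ball 0 ?R"
      unfolding fdiff_def by (rule holomorphic_on_diff)
    show "real n * (1 + r) < ?R"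
      using Suc.prems(4) by (simp add: algebra_simps)
  qed (use diff_le \<open>r > 0\<close> in auto)
  then show ?case
    by (simp add: funpow_swap1)
qed force

text \<open>Differencing \<open>n\<close> times gains a factor of order \<open>norm w ^ n\<close> as soon as \<open>g\<close> extends
  holomorphically, with the same order of magnitude, to a complex disc around \<open>w\<close>
  in the direction of \<open>h\<close> whose radius is proportional to \<open>norm w\<close>.\<close>

lemma norm_fdiff_funpow_le:
  assumes "h \<noteq> 0" and w: "norm w \<ge> 8 * real (n + 1) * norm h"
    and f: "f holomorphic_on ball 0 (norm w / (2 * norm h))"
    and fB: "\<And>t. t \<in> ball 0 (norm w / (2 * norm h)) \<Longrightarrow> norm (f t) \<le> B"
    and fg: "\<And>j. j \<le> n \<Longrightarrow> f (of_nat j) = g (w + of_nat j * h)"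
  shows "norm ((fdiff h ^^ n) g w) \<le> B * (4 * real (n + 1) * norm h / norm w) ^ n"
proof -
  \<comment> \<open>The disc of radius norm w / (2 norm h) has to survive n losses of 1 + r. This r
    makes 2(n + 1)r equal to that radius, and the lower bound on norm w gives r \<ge> 2, hence 1 + r
    \<le> 2r.\<close>
  define r where "r = norm w / (4 * real (n + 1) * norm h)"
  have h: "norm h > 0" using \<open>h \<noteq> 0\<close> by simp
  have w0: "norm w > 0"
    by (rule less_le_trans[OF _ w]) (use h in simp)
  have "(fdiff h ^^ n) g w = (fdiff 1 ^^ n) f 0"
    by (rule fdiff_funpow_eq) (use fg in simp)
  also have "norm \<dots> \<le> B / r ^ n"
  proof (rule norm_fdiff_funpow_le_aux[OF f fB])
    show "r > 0" using h w0 by (simp add: r_def)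
    have "4 * real (n + 1) * norm h > 0" using h by simp
    then have "r \<ge> 2" unfolding r_def using w by (subst pos_le_divide_eq) (auto simp: algebra_simps)
    have "2 * N * (W / (4 * N * H)) = W / (2 * H)" if "N \<noteq> 0" for N W H :: real
      using that by simp
    then have r: "2 * real (n + 1) * r = norm w / (2 * norm h)"
      unfolding r_def by (metis of_nat_eq_0_iff Suc_eq_plus1 nat.distinct(1))
    have "real n * (1 + r) \<le> real n * (2 * r)"
      using \<open>r \<ge> 2\<close> by (intro mult_left_mono) auto
    also have "\<dots> < 2 * real (n + 1) * r"
      using \<open>r > 0\<close> by (simp add: algebra_simps)
    also note r
    finally show "real n * (1 + r) < norm w / (2 * norm h)" .
  qed
  also have "\<dots> = B * (4 * real (n + 1) * norm h / norm w) ^ n"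
    by (simp add: r_def power_divide)
  finally show ?thesis .
qed

section \<open>The period lattice\<close>

lemma summable_on_int_powr:
  assumes "q > (1 :: real)"
  shows "(\<lambda>m :: int. (1 + \<bar>of_int m\<bar>) powr (- q)) summable_on UNIV"
proof -
  let ?f = "\<lambda>m :: int. (1 + \<bar>of_int m\<bar> :: real) powr (- q)"
  have "summable (\<lambda>n. of_nat n powr (- q) :: real)"
    using assms by (subst summable_real_powr_iff) simp
  then have "summable (\<lambda>n. of_nat (Suc n) powr (- q) :: real)"
    by (subst summable_Suc_iff)
  then have nat: "(\<lambda>n. of_nat (Suc n) powr (- q) :: real) summable_on (UNIV :: nat set)"
    by (intro norm_summable_imp_summable_on) simp
  have inj: "inj (int :: nat \<Rightarrow> int)" "inj (\<lambda>n. - int n)"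
    by (auto simp: inj_def)
  have "?f summable_on range int"
    by (subst summable_on_reindex[OF inj(1)]) (use nat in \<open>simp add: o_def add_ac\<close>)
  moreover have "?f summable_on range (\<lambda>n. - int n)"
    by (subst summable_on_reindex[OF inj(2)]) (use nat in \<open>simp add: o_def add_ac\<close>)
  ultimately have "?f summable_on (range int \<union> range (\<lambda>n. - int n))"
    by (rule summable_on_union)
  moreover have "range int \<union> range (\<lambda>n. - int n) = UNIV"
  proof -
    have "m \<in> range int \<union> range (\<lambda>n. - int n)" for m
      by (cases m rule: int_cases2) auto
    then show ?thesis by blast
  qed
  ultimately show ?thesis by simp
qed

locale lattice =
  fixes \<tau> :: complex
  assumes Im_pos: "Im \<tau> > 0"
begin

abbreviation "L \<equiv> period_lattice \<tau>"

lemma zero_in_L [simp]: "0 \<in> L"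
  by (auto simp: period_lattice_def intro!: exI[of _ 0])

lemma one_in_L: "1 \<in> L"
proof -
  have "1 = of_int 1 + of_int 0 * \<tau>" by simp
  then show ?thesis unfolding period_lattice_def by blast
qed

lemma tau_in_L: "\<tau> \<in> L"
proof -
  have "\<tau> = of_int 0 + of_int 1 * \<tau>" by simp
  then show ?thesis unfolding period_lattice_def by blast
qed

lemma add_in_L: "v \<in> L \<Longrightarrow> w \<in> L \<Longrightarrow> v + w \<in> L"
proof -
  assume "v \<in> L" "w \<in> L"
  then obtain a b c d :: int where "v = of_int a + of_int b * \<tau>" "w = of_int c + of_int d * \<tau>"
    by (auto simp: period_lattice_def)
  then have "v + w = of_int (a + c) + of_int (b + d) * \<tau>"
    by (simp add: algebra_simps)
  then show ?thesis unfolding period_lattice_def by blast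
qed

lemma minus_in_L: "w \<in> L \<Longrightarrow> - w \<in> L"
proof -
  assume "w \<in> L"
  then obtain c d :: int where "w = of_int c + of_int d * \<tau>"
    by (auto simp: period_lattice_def)
  then have "- w = of_int (- c) + of_int (- d) * \<tau>"
    by (simp add: algebra_simps)
  then show ?thesis unfolding period_lattice_def by blast
qed

lemma minus_in_L_iff [simp]: "- w \<in> L \<longleftrightarrow> w \<in> L"
  using minus_in_L[of w] minus_in_L[of "- w"] by auto

lemma add_in_L_iff: "v \<in> L \<Longrightarrow> w + v \<in> L \<longleftrightarrow> w \<in> L"
  using add_in_L[of w v] add_in_L[of "w + v" "- v"] by auto

lemma bij_betw_shift_L: "v \<in> L \<Longrightarrow> bij_betw (\<lambda>w. w + v) L L"
  by (rule bij_betwI[where g = "\<lambda>w. w - v"])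
    (auto simp: add_in_L_iff minus_in_L_iff, metis add_in_L_iff diff_add_cancel)

text \<open>For w = m + n\<tau> the first two summands bound |m| and the last one bounds |n|. A
  nonzero lattice vector has a coordinate of absolute value at least 1, so the ball of radius
  \<open>1 / coord_bound\<close> about 0 meets L only in 0; all local expansions live on this
  ball.\<close>

definition coord_bound :: real where
  "coord_bound = 1 + cmod \<tau> / Im \<tau> + 1 / Im \<tau>"

lemma coord_bound_ge_1: "coord_bound \<ge> 1"
  using Im_pos by (simp add: coord_bound_def)

lemma coord_le:
  fixes m n :: int
  shows "\<bar>of_int m\<bar> \<le> coord_bound * cmod (of_int m + of_int n * \<tau>)"
    and "\<bar>of_int n\<bar> \<le> coord_bound * cmod (of_int m + of_int n * \<tau>)"
proof -
  define w where "w = of_int m + of_int n * \<tau>"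
  have "\<bar>of_int n\<bar> * Im \<tau> = \<bar>Im w\<bar>"
    using Im_pos by (simp add: w_def abs_mult)
  also have "\<dots> \<le> cmod w" by (rule abs_Im_le_cmod)
  finally have n: "\<bar>of_int n\<bar> \<le> cmod w / Im \<tau>"
    using Im_pos by (simp add: field_simps)
  have "of_int m = w - of_int n * \<tau>" by (simp add: w_def)
  then have "cmod (of_int m) \<le> cmod w + cmod (of_int n * \<tau>)"
    by (metis norm_triangle_ineq4)
  then have "\<bar>of_int m\<bar> \<le> cmod w + \<bar>of_int n\<bar> * cmod \<tau>"
    by (simp add: norm_mult)
  also have "\<dots> \<le> cmod w + cmod w / Im \<tau> * cmod \<tau>"
    by (intro add_left_mono mult_right_mono n) simp
  also have "\<dots> \<le> coord_bound * cmod w"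
    using Im_pos by (simp add: coord_bound_def algebra_simps)
  finally show "\<bar>of_int m\<bar> \<le> coord_bound * cmod (of_int m + of_int n * \<tau>)"
    by (simp add: w_def)
  have "cmod w / Im \<tau> \<le> coord_bound * cmod w"
    using Im_pos by (simp add: coord_bound_def algebra_simps)
  with n show "\<bar>of_int n\<bar> \<le> coord_bound * cmod (of_int m + of_int n * \<tau>)"
    by (simp add: w_def)
qed

lemma norm_L_ge:
  assumes "w \<in> L" "w \<noteq> 0"
  shows "1 \<le> coord_bound * cmod w"
proof -
  obtain m n :: int where w: "w = of_int m + of_int n * \<tau>"
    using assms by (auto simp: period_lattice_def)
  with assms have "m \<noteq> 0 \<or> n \<noteq> 0" by auto
  then have "1 \<le> \<bar>m\<bar> \<or> 1 \<le> \<bar>n\<bar>" by auto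
  then have "(1 :: real) \<le> \<bar>of_int m\<bar> \<or> (1 :: real) \<le> \<bar>of_int n\<bar>"
    by (simp flip: of_int_abs)
  then show ?thesis
    using coord_le(1)[of m n] coord_le(2)[of n m] by (auto simp: w)
qed

lemma closed_L: "closed L"
proof (rule discrete_imp_closed)
  show "0 < 1 / coord_bound" using coord_bound_ge_1 by simp
  show "\<forall>x\<in>L. \<forall>y\<in>L. dist y x < 1 / coord_bound \<longrightarrow> y = x"
  proof (intro ballI impI, rule ccontr)
    fix x y assume *: "x \<in> L" "y \<in> L" "dist y x < 1 / coord_bound" "y \<noteq> x"
    then have "1 \<le> coord_bound * cmod (y + - x)"
      by (intro norm_L_ge add_in_L) auto
    with * show False
      using coord_bound_ge_1 by (simp add: dist_norm field_simps)
  qed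
qed

lemma finite_L_norm_less: "finite {w \<in> L. cmod w < R}"
proof -
  obtain K :: int where K: "coord_bound * R \<le> of_int K"
    using ex_le_of_int by blast
  have "{w \<in> L. cmod w < R} \<subseteq> (\<lambda>(m, n). of_int m + of_int n * \<tau>) ` ({-K..K} \<times> {-K..K})"
  proof
    fix w assume "w \<in> {w \<in> L. cmod w < R}"
    then obtain m n :: int where w: "w = of_int m + of_int n * \<tau>" "cmod w < R"
      by (auto simp: period_lattice_def)
    have "coord_bound * cmod w \<le> coord_bound * R"
      using coord_bound_ge_1 w(2) by (intro mult_left_mono) auto
    then have "\<bar>of_int m\<bar> \<le> (of_int K :: real)" "\<bar>of_int n\<bar> \<le> (of_int K :: real)"
      using coord_le(1)[of m n] coord_le(2)[of n m] K w(1) by auto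
    then have "\<bar>m\<bar> \<le> K" "\<bar>n\<bar> \<le> K"
      by linarith+
    then show "w \<in> (\<lambda>(m, n). of_int m + of_int n * \<tau>) ` ({-K..K} \<times> {-K..K})"
      unfolding w(1) by (intro image_eqI[where x = "(m, n)"]) auto
  qed
  then show ?thesis by (rule finite_subset) auto
qed

text \<open>With c = \<open>coord_bound\<close> and w \<noteq> 0, (1 + |m|)(1 + |n|) \<le>
  (2c|w|)^2, so |w|^(-q) is dominated by a product of two one-dimensional terms with exponent q/2 >
  1. At w = 0 the power of 0 is 0 by convention.\<close>

lemma summable_on_L_powr:
  assumes "q > 2"
  shows "(\<lambda>w. cmod w powr (- q)) summable_on L"
proof -
  define f where "f = (\<lambda>m :: int. (1 + \<bar>of_int m\<bar> :: real) powr (- (q / 2)))"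
  have f: "f summable_on UNIV"
    unfolding f_def using assms by (intro summable_on_int_powr) simp
  have f_nonneg: "f m \<ge> 0" for m by (simp add: f_def)
  have "(\<lambda>(m, n). f m * f n) summable_on UNIV \<times> UNIV"
  proof (rule summable_on_SigmaI[where g = "\<lambda>m. f m * infsum f UNIV"])
    show "((\<lambda>n. case (m, n) of (m, n) \<Rightarrow> f m * f n) has_sum f m * infsum f UNIV) UNIV" for m
      using has_sum_cmult_right[OF has_sum_infsum[OF f]] by simp
    show "(\<lambda>m. f m * infsum f UNIV) summable_on UNIV"
      by (rule summable_on_cmult_left[OF f])
  qed (auto simp: f_nonneg)
  then have "(\<lambda>mn. (2 * coord_bound) powr q * (case mn of (m, n) \<Rightarrow> f m * f n)) summable_on UNIV"
    by (intro summable_on_cmult_right) simp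
  then have summ: "(\<lambda>mn :: int \<times> int.
      cmod (of_int (fst mn) + of_int (snd mn) * \<tau>) powr (- q)) summable_on UNIV"
  proof (rule summable_on_comparison_test)
    fix mn :: "int \<times> int"
    obtain m n where mn: "mn = (m, n)" by force
    define w where "w = of_int m + of_int n * \<tau>"
    show "cmod (of_int (fst mn) + of_int (snd mn) * \<tau>) powr (- q) \<le>
        (2 * coord_bound) powr q * (case mn of (m, n) \<Rightarrow> f m * f n)"
    proof (cases "w = 0")
      case False
      have "w \<in> L" by (auto simp: w_def period_lattice_def)
      with False have w1: "1 \<le> coord_bound * cmod w" by (intro norm_L_ge)
      have sq: "(X * X) powr (- (q / 2)) = X powr (- q)" if "X \<ge> 0" for X :: real
        using that by (simp add: powr_mult flip: powr_add)
      have "(1 + \<bar>of_int m\<bar>) * (1 + \<bar>of_int n\<bar>) \<le> (2 * coord_bound * cmod w) * (2 * coord_bound * cmod w)"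
        using coord_le(1)[of m n] coord_le(2)[of n m] w1 unfolding w_def by (intro mult_mono) auto
      then have "((2 * coord_bound * cmod w) * (2 * coord_bound * cmod w)) powr (- (q / 2))
          \<le> ((1 + \<bar>of_int m\<bar>) * (1 + \<bar>of_int n\<bar>)) powr (- (q / 2))"
        using assms by (intro powr_mono2') auto
      also have "\<dots> = f m * f n"
        by (simp add: f_def powr_mult)
      also have "((2 * coord_bound * cmod w) * (2 * coord_bound * cmod w)) powr (- (q / 2)) =
          (2 * coord_bound * cmod w) powr (- q)"
        using coord_bound_ge_1 by (intro sq) simp
      finally have "(2 * coord_bound) powr (- q) * cmod w powr (- q) \<le> f m * f n"
        using coord_bound_ge_1 by (simp add: powr_mult)
      then have "(2 * coord_bound) powr q * ((2 * coord_bound) powr (- q) * cmod w powr (- q))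
          \<le> (2 * coord_bound) powr q * (f m * f n)"
        by (rule mult_left_mono) simp
      then have "((2 * coord_bound) powr q * (2 * coord_bound) powr (- q)) * cmod w powr (- q)
          \<le> (2 * coord_bound) powr q * (f m * f n)"
        by (simp only: mult.assoc)
      then show ?thesis
        using coord_bound_ge_1 by (simp add: mn w_def flip: powr_add)
    qed (simp add: mn w_def f_nonneg)
  qed simp
  have inj: "inj (\<lambda>mn :: int \<times> int. of_int (fst mn) + of_int (snd mn) * \<tau>)"
    using Im_pos by (auto simp: inj_def complex_eq_iff)
  have "(\<lambda>w. cmod w powr (- q)) summable_on range (\<lambda>mn :: int \<times> int. of_int (fst mn) + of_int (snd mn) * \<tau>)"
    by (subst summable_on_reindex[OF inj]) (use summ in \<open>simp add: o_def\<close>)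
  moreover have "range (\<lambda>mn :: int \<times> int. of_int (fst mn) + of_int (snd mn) * \<tau>) = L"
    by (auto simp: period_lattice_def image_iff split_paired_Ex) blast
  ultimately show ?thesis by simp
qed

end

section \<open>Twisted lattice sums\<close>

text \<open>\<open>h\<close> plays two roles: it witnesses that \<psi> is nontrivial, and it is the
  direction in which all sums for \<psi> are differenced.\<close>

locale lattice_character = lattice +
  fixes \<psi> :: "complex \<Rightarrow> complex" and h :: complex
  assumes norm_psi: "w \<in> L \<Longrightarrow> norm (\<psi> w) = 1"
    and psi_add: "v \<in> L \<Longrightarrow> w \<in> L \<Longrightarrow> \<psi> (v + w) = \<psi> v * \<psi> w"
    and h_in_L: "h \<in> L"
    and psi_h: "\<psi> h \<noteq> 1"
begin

lemma psi_nonzero: "w \<in> L \<Longrightarrow> \<psi> w \<noteq> 0"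
  using norm_psi by force

lemma psi_0: "\<psi> 0 = 1"
  using psi_add[of 0 0] psi_nonzero[of 0] by simp

lemma of_nat_mult_h_in_L: "of_nat j * h \<in> L"
  by (induction j) (simp_all add: add_in_L h_in_L algebra_simps)

lemma h_nonzero: "h \<noteq> 0"
  using psi_h psi_0 by auto

text \<open>The factor by which one difference multiplies a twisted sum: shifting w by h contributes
  1 / \<psi> h, the subtracted term contributes 1.\<close>

definition kappa :: complex where
  "kappa = 1 / \<psi> h - 1"

lemma kappa_nonzero: "kappa \<noteq> 0"
  using psi_h psi_nonzero[OF h_in_L] by (simp add: kappa_def field_simps)

text \<open>Since \<open>\<psi> h \<noteq> 1\<close>, summation by parts in the direction \<open>h\<close> makes this independent of \<open>N\<close>
  wherever the series converges, and larger values of \<open>N\<close> make it converge for more \<open>g\<close>.\<close>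

definition twisted_sum :: "nat \<Rightarrow> (complex \<Rightarrow> complex) \<Rightarrow> complex" where
  "twisted_sum N g = (\<Sum>\<^sub>\<infinity>w\<in>L. \<psi> w * (fdiff h ^^ N) g w) / kappa ^ N"

definition diff_summable :: "nat \<Rightarrow> (complex \<Rightarrow> complex) \<Rightarrow> bool" where
  "diff_summable N g \<longleftrightarrow> (\<lambda>w. norm ((fdiff h ^^ N) g w)) summable_on L"

lemma summable_on_L_if_bounded:
  fixes g :: "complex \<Rightarrow> 'b :: real_normed_vector"
  assumes "q > 2" "\<And>w. w \<in> L \<Longrightarrow> norm w \<ge> R \<Longrightarrow> norm (g w) \<le> C * norm w powr (- q)"
  shows "(\<lambda>w. norm (g w)) summable_on L"
proof -
  have "(\<lambda>w. C * norm w powr (- q)) summable_on {w \<in> L. norm w \<ge> R}"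
    by (rule summable_on_subset_banach[OF summable_on_cmult_right[OF summable_on_L_powr]])
      (use assms in auto)
  then have "(\<lambda>w. norm (g w)) summable_on {w \<in> L. norm w \<ge> R}"
    by (rule summable_on_comparison_test) (use assms in auto)
  moreover have "(\<lambda>w. norm (g w)) summable_on {w \<in> L. norm w < R}"
    by (intro summable_on_finite finite_L_norm_less)
  ultimately have "(\<lambda>w. norm (g w)) summable_on {w \<in> L. norm w \<ge> R} \<union> {w \<in> L. norm w < R}"
    by (rule summable_on_union)
  moreover have "{w \<in> L. norm w \<ge> R} \<union> {w \<in> L. norm w < R} = L"
    by auto
  ultimately show ?thesis by simp
qed

lemma diff_summable_psi:
  assumes "diff_summable N g"
  shows "(\<lambda>w. \<psi> w * (fdiff h ^^ N) g w) summable_on L"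
proof -
  have "(\<lambda>w. norm (\<psi> w * (fdiff h ^^ N) g w)) summable_on L \<longleftrightarrow>
      (\<lambda>w. norm ((fdiff h ^^ N) g w)) summable_on L"
    by (intro summable_on_cong) (simp add: norm_mult norm_psi)
  then show ?thesis
    using assms unfolding diff_summable_def by (metis abs_summable_summable)
qed

text \<open>Source of every multiplier in the proof. Reindexing and scaling commute with
  \<open>infsum\<close> unconditionally, a divergent sum having the value 0.\<close>

lemma infsum_L_psi_shift:
  assumes "v \<in> L"
  shows "(\<Sum>\<^sub>\<infinity>w\<in>L. \<psi> w * g (w + v)) = (\<Sum>\<^sub>\<infinity>w\<in>L. \<psi> w * g w) / \<psi> v"
proof -
  have "(\<Sum>\<^sub>\<infinity>w\<in>L. \<psi> w * g w) = (\<Sum>\<^sub>\<infinity>w\<in>L. \<psi> (w + v) * g (w + v))"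
    by (rule infsum_reindex_bij_betw[OF bij_betw_shift_L[OF assms], symmetric])
  also have "\<dots> = (\<Sum>\<^sub>\<infinity>w\<in>L. \<psi> v * (\<psi> w * g (w + v)))"
    by (rule infsum_cong) (simp add: psi_add assms)
  also have "\<dots> = \<psi> v * (\<Sum>\<^sub>\<infinity>w\<in>L. \<psi> w * g (w + v))"
    by (rule infsum_cmult_right')
  finally show ?thesis
    using psi_nonzero[OF assms] by simp
qed

lemma summable_on_L_shift:
  assumes "v \<in> L"
  shows "(\<lambda>w. g (w + v)) summable_on L \<longleftrightarrow> g summable_on L"
  by (rule summable_on_reindex_bij_betw[OF bij_betw_shift_L[OF assms]])

lemma diff_summable_Suc:
  assumes "diff_summable N g"
  shows "diff_summable (Suc N) g"
proof -
  have "(\<lambda>w. norm ((fdiff h ^^ N) g (w + h)) + norm ((fdiff h ^^ N) g w)) summable_on L"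
    by (intro summable_on_add iffD2[OF summable_on_L_shift[OF h_in_L]])
      (use assms in \<open>simp_all add: diff_summable_def\<close>)
  then show ?thesis
    unfolding diff_summable_def
    by (rule summable_on_comparison_test) (simp_all only: fdiff_funpow_Suc norm_triangle_ineq4 norm_ge_zero)
qed

lemma twisted_sum_Suc:
  assumes "diff_summable N g"
  shows "twisted_sum (Suc N) g = twisted_sum N g"
proof -
  let ?g = "(fdiff h ^^ N) g"
  note 1 = diff_summable_psi[OF assms]
  have "(\<lambda>w. \<psi> (w + h) * ?g (w + h)) summable_on L"
    using 1 by (subst summable_on_L_shift[OF h_in_L])
  then have "(\<lambda>w. \<psi> h * (\<psi> w * ?g (w + h))) summable_on L"
    by (rule summable_on_cong[THEN iffD1, rotated]) (simp add: psi_add h_in_L)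
  then have 2: "(\<lambda>w. \<psi> w * ?g (w + h)) summable_on L"
    using psi_nonzero[OF h_in_L] by (subst (asm) summable_on_cmult_right') auto
  have "(\<Sum>\<^sub>\<infinity>w\<in>L. \<psi> w * (fdiff h ^^ Suc N) g w) =
      (\<Sum>\<^sub>\<infinity>w\<in>L. \<psi> w * ?g (w + h) - \<psi> w * ?g w)"
    by (simp only: fdiff_funpow_Suc right_diff_distrib)
  also have "\<dots> = (\<Sum>\<^sub>\<infinity>w\<in>L. \<psi> w * ?g (w + h)) - (\<Sum>\<^sub>\<infinity>w\<in>L. \<psi> w * ?g w)"
    using infsumI[OF has_sum_add[OF has_sum_infsum[OF 2] has_sum_uminusI[OF has_sum_infsum[OF 1]]]]
    by simp
  also have "\<dots> = kappa * (\<Sum>\<^sub>\<infinity>w\<in>L. \<psi> w * ?g w)"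
    by (subst infsum_L_psi_shift[OF h_in_L]) (simp add: kappa_def algebra_simps)
  finally show ?thesis
    using kappa_nonzero by (simp add: twisted_sum_def)
qed

lemma twisted_sum_mono:
  assumes "diff_summable N g" "N \<le> N'"
  shows "diff_summable N' g \<and> twisted_sum N' g = twisted_sum N g"
  using assms(2)
proof (induction N' rule: dec_induct)
  case (step n)
  then show ?case
    by (simp add: diff_summable_Suc twisted_sum_Suc)
qed (use assms in auto)

section \<open>Linearity, shifts and holomorphic dependence of twisted sums\<close>

lemma twisted_sum_add:
  assumes "diff_summable N f" "diff_summable N g"
  shows "diff_summable N (\<lambda>w. f w + g w)"
    and "twisted_sum N (\<lambda>w. f w + g w) = twisted_sum N f + twisted_sum N g"
proof -
  have "(\<lambda>w. norm ((fdiff h ^^ N) f w) + norm ((fdiff h ^^ N) g w)) summable_on L"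
    using assms by (intro summable_on_add) (auto simp: diff_summable_def)
  then show "diff_summable N (\<lambda>w. f w + g w)"
    unfolding diff_summable_def
    by (rule summable_on_comparison_test)
      (simp_all only: fdiff_funpow_add norm_triangle_ineq norm_ge_zero)
  show "twisted_sum N (\<lambda>w. f w + g w) = twisted_sum N f + twisted_sum N g"
    unfolding twisted_sum_def fdiff_funpow_add distrib_left
    by (subst infsum_add) (use assms in \<open>auto intro: diff_summable_psi simp: add_divide_distrib\<close>)
qed

lemma twisted_sum_cmult:
  shows "diff_summable N g \<Longrightarrow> diff_summable N (\<lambda>w. c * g w)"
    and "twisted_sum N (\<lambda>w. c * g w) = c * twisted_sum N g"
proof -
  show "diff_summable N (\<lambda>w. c * g w)" if "diff_summable N g"
    using summable_on_cmult_right[of "\<lambda>w. norm ((fdiff h ^^ N) g w)" L "norm c"] that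
    by (simp add: diff_summable_def fdiff_funpow_cmult norm_mult)
  have "(\<Sum>\<^sub>\<infinity>w\<in>L. \<psi> w * (c * (fdiff h ^^ N) g w)) =
      (\<Sum>\<^sub>\<infinity>w\<in>L. c * (\<psi> w * (fdiff h ^^ N) g w))"
    by (simp only: mult.left_commute)
  then show "twisted_sum N (\<lambda>w. c * g w) = c * twisted_sum N g"
    by (simp add: twisted_sum_def fdiff_funpow_cmult infsum_cmult_right')
qed

lemma twisted_sum_shift:
  assumes "v \<in> L"
  shows "twisted_sum N (\<lambda>w. g (w + v)) = twisted_sum N g / \<psi> v"
  by (simp add: twisted_sum_def fdiff_funpow_shift infsum_L_psi_shift[OF assms])

text \<open>Weierstrass M-test on a small closed disc: for norm w \<ge> R the hypothesis gives a
  majorant uniform in u, and for the finitely many other w continuity on the compact disc gives some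
  bound.\<close>

lemma holomorphic_on_psi_infsum:
  assumes "open S" and hol: "\<And>w. w \<in> L \<Longrightarrow> (\<lambda>u. g u w) holomorphic_on S"
    and bnd: "\<And>v. v \<in> S \<Longrightarrow> \<exists>e>0. \<exists>q>2. \<exists>C R. \<forall>u\<in>ball v e. \<forall>w\<in>L.
               R \<le> norm w \<longrightarrow> norm (g u w) \<le> C * norm w powr (- q)"
  shows "(\<lambda>u. \<Sum>\<^sub>\<infinity>w\<in>L. \<psi> w * g u w) holomorphic_on S"
proof -
  have "(\<lambda>u. \<Sum>\<^sub>\<infinity>w\<in>L. \<psi> w * g u w) field_differentiable (at v within S)" if "v \<in> S" for v
  proof -
    obtain e q C R where e: "e > 0" and q: "q > 2" and
      C: "\<And>u w. u \<in> ball v e \<Longrightarrow> w \<in> L \<Longrightarrow> R \<le> norm w \<Longrightarrow> norm (g u w) \<le> C * norm w powr (- q)"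
      using bnd[OF \<open>v \<in> S\<close>] by blast
    obtain e' where e': "e' > 0" "cball v e' \<subseteq> S"
      using \<open>open S\<close> \<open>v \<in> S\<close> open_contains_cball by blast
    define r where "r = min e' (e / 2)"
    have r: "r > 0" "cball v r \<subseteq> S" "cball v r \<subseteq> ball v e"
      using e e' by (auto simp: r_def)
    have "\<exists>M. \<forall>u\<in>cball v r. norm (g u w) \<le> M" if "w \<in> L" for w
    proof -
      have "compact ((\<lambda>u. g u w) ` cball v r)"
        using hol[OF that] r(2)
        by (intro compact_continuous_image compact_cball holomorphic_on_imp_continuous_on)
          (rule holomorphic_on_subset)
      from compact_imp_bounded[OF this] show ?thesis
        by (auto simp: bounded_iff)
    qed
    then obtain M where M: "\<And>w u. w \<in> L \<Longrightarrow> u \<in> cball v r \<Longrightarrow> norm (g u w) \<le> M w"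
      by metis
    define M' where "M' = (\<lambda>w. if R \<le> norm w then C * norm w powr (- q) else M w)"
    have "(\<lambda>w. norm (M' w)) summable_on L"
    proof (rule summable_on_L_if_bounded[OF q])
      show "norm (M' w) \<le> \<bar>C\<bar> * norm w powr (- q)" if "R \<le> norm w" for w
        using that by (simp add: M'_def abs_mult)
    qed
    then have M'_summable: "M' summable_on L"
      by (rule abs_summable_summable)
    have ulim: "uniform_limit (cball v r) (\<lambda>X u. \<Sum>w\<in>X. \<psi> w * g u w)
        (\<lambda>u. \<Sum>\<^sub>\<infinity>w\<in>L. \<psi> w * g u w) (finite_subsets_at_top L)"
      by (rule Weierstrass_m_test_general[OF _ M'_summable])
        (use r C M in \<open>auto simp: M'_def norm_mult norm_psi\<close>)
    have hol': "(\<lambda>u. \<Sum>w\<in>X. \<psi> w * g u w) holomorphic_on S" if "X \<subseteq> L" for X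
      using that by (intro holomorphic_intros hol) auto
    have "\<forall>\<^sub>F X in finite_subsets_at_top L.
        continuous_on (cball v r) (\<lambda>u. \<Sum>w\<in>X. \<psi> w * g u w) \<and>
        (\<lambda>u. \<Sum>w\<in>X. \<psi> w * g u w) holomorphic_on ball v r"
    proof (rule eventually_finite_subsets_at_top_weakI)
      show "continuous_on (cball v r) (\<lambda>u. \<Sum>w\<in>X. \<psi> w * g u w) \<and>
          (\<lambda>u. \<Sum>w\<in>X. \<psi> w * g u w) holomorphic_on ball v r" if "X \<subseteq> L" for X
        using hol'[OF that] r(2) ball_subset_cball[of v r]
        by (meson continuous_on_subset holomorphic_on_imp_continuous_on holomorphic_on_subset order.trans)
    qed
    then have "(\<lambda>u. \<Sum>\<^sub>\<infinity>w\<in>L. \<psi> w * g u w) holomorphic_on ball v r"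
      using holomorphic_uniform_limit[OF _ ulim] by (simp add: finite_subsets_at_top_neq_bot)
    then have "(\<lambda>u. \<Sum>\<^sub>\<infinity>w\<in>L. \<psi> w * g u w) field_differentiable (at v)"
      using r(1) by (simp add: holomorphic_on_def at_within_open[where S = "ball v r"])
    then show ?thesis
      by (rule field_differentiable_at_within)
  qed
  then show ?thesis
    by (simp add: holomorphic_on_def)
qed

lemma holomorphic_on_twisted_sum:
  assumes "open S" and hol: "\<And>w. w \<in> L \<Longrightarrow> (\<lambda>u. g u w) holomorphic_on S"
    and bnd: "\<And>v. v \<in> S \<Longrightarrow> \<exists>e>0. \<exists>q>2. \<exists>C R. \<forall>u\<in>ball v e. \<forall>w\<in>L.
               R \<le> norm w \<longrightarrow> norm ((fdiff h ^^ N) (g u) w) \<le> C * norm w powr (- q)"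
  shows "(\<lambda>u. twisted_sum N (g u)) holomorphic_on S"
proof -
  have "(\<lambda>u. \<Sum>\<^sub>\<infinity>w\<in>L. \<psi> w * (fdiff h ^^ N) (g u) w) holomorphic_on S"
    by (intro holomorphic_on_psi_infsum assms(1) holomorphic_fdiff_funpow hol bnd add_in_L of_nat_mult_h_in_L)
  then show ?thesis
    unfolding twisted_sum_def using kappa_nonzero by (intro holomorphic_intros) auto
qed

end

section \<open>Analytic continuation of the Kronecker series\<close>

text \<open>The value at w = 0 is 0, since a complex power of 0 is 0, so the sums can run over all
  of L and differences can step across the origin.\<close>

definition kronecker_term :: "nat \<Rightarrow> complex \<Rightarrow> complex \<Rightarrow> complex" where
  "kronecker_term a s w = cnj w ^ a * of_real (cmod w) powr (- 2 * s)"

lemma kronecker_term_0 [simp]: "kronecker_term a s 0 = 0"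
  by (simp add: kronecker_term_def)

text \<open>At s = k the absolute value cancels the conjugates, and the terms become meromorphic in
  w; this links the continuation with the Kronecker function.\<close>

lemma kronecker_term_nat:
  assumes "k > 0"
  shows "kronecker_term k (of_nat k) w = inverse w ^ k"
proof (cases "w = 0")
  case False
  have "- 2 * of_nat k = - (of_nat (2 * k) :: complex)"
    by simp
  then have "complex_of_real (cmod w) powr (- 2 * of_nat k) = inverse (of_real (cmod w) ^ (2 * k))"
    using False by (simp only: powr_minus powr_nat' of_real_eq_0_iff norm_eq_zero simp_thms)
  also have "complex_of_real (cmod w) ^ (2 * k) = (w * cnj w) ^ k"
    by (simp only: power_mult complex_norm_square[symmetric] of_real_power)
  finally have *: "complex_of_real (cmod w) powr (- 2 * of_nat k) = inverse ((w * cnj w) ^ k)" .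
  have "cnj w ^ k * inverse ((w * cnj w) ^ k) = inverse w ^ k"
    using False by (simp add: power_mult_distrib power_inverse)
  then show ?thesis
    by (simp only: kronecker_term_def *)
qed (use assms in simp)

text \<open>Put \<alpha> = h / w. For real t with |t\<alpha>| < 1/2, |1 + t\<alpha>|^(-2s) equals
  exp(-s(Ln(1 + t\<alpha>) + Ln(1 + t cnj \<alpha>))), and the conjugate of w + th is cnj w (1 + t
  cnj \<alpha>). Both right-hand sides are holomorphic for complex t with |t\<alpha>| < 1/2. There
  |1 + t cnj \<alpha>| \<le> 2 and each logarithm has norm at most 1, whence 2^a and
  exp(2|s|).\<close>

lemma norm_fdiff_kronecker_term_le:
  assumes "h \<noteq> 0" and w: "norm w \<ge> 8 * real (n + 1) * norm h"
  shows "norm ((fdiff h ^^ n) (kronecker_term a s) w) \<le>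
           2 ^ a * exp (2 * norm s) * (4 * real (n + 1) * norm h) ^ n
             * norm w powr (real a - 2 * Re s - real n)"
proof -
  define \<alpha> where "\<alpha> = h / w"
  define f where "f = (\<lambda>t. (cnj w * (1 + t * cnj \<alpha>)) ^ a * of_real (cmod w) powr (- 2 * s)
                       * exp (- s * (Ln (1 + t * \<alpha>) + Ln (1 + t * cnj \<alpha>))))"
  have h: "norm h > 0" using \<open>h \<noteq> 0\<close> by simp
  have w0: "norm w > 0"
    by (rule less_le_trans[OF _ w]) (use h in simp)
  then have [simp]: "w \<noteq> 0" by auto
  have small: "norm (t * \<alpha>) < 1 / 2" if "t \<in> ball 0 (norm w / (2 * norm h))" for t
    using that h w0 by (simp add: \<alpha>_def norm_mult norm_divide field_simps)
  have small': "norm (t * cnj \<alpha>) < 1 / 2" if "t \<in> ball 0 (norm w / (2 * norm h))" for t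
    using small[OF that] by (simp add: norm_mult)
  have not_neg: "1 + z \<notin> \<real>\<^sub>\<le>\<^sub>0" if "norm z < 1 / 2" for z :: complex
    using that abs_Re_le_cmod[of z] by (auto simp: complex_nonpos_Reals_iff)
  have "norm ((fdiff h ^^ n) (kronecker_term a s) w) \<le>
      2 ^ a * norm w ^ a * norm w powr (- 2 * Re s) * exp (2 * norm s)
        * (4 * real (n + 1) * norm h / norm w) ^ n"
  proof (rule norm_fdiff_funpow_le[OF assms, of f])
    show "f holomorphic_on ball 0 (norm w / (2 * norm h))"
      unfolding f_def by (intro holomorphic_intros) (use not_neg small small' in blast)+
    show "norm (f t) \<le> 2 ^ a * norm w ^ a * norm w powr (- 2 * Re s) * exp (2 * norm s)"
      if t: "t \<in> ball 0 (norm w / (2 * norm h))" for t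
    proof -
      have "norm (1 + t * cnj \<alpha>) \<le> 2"
        using norm_triangle_ineq[of 1 "t * cnj \<alpha>"] small'[OF t] by simp
      then have 1: "norm ((cnj w * (1 + t * cnj \<alpha>)) ^ a) \<le> (norm w * 2) ^ a"
        unfolding norm_power norm_mult by (intro power_mono mult_left_mono) auto
      have 2: "norm (exp (- s * (Ln (1 + t * \<alpha>) + Ln (1 + t * cnj \<alpha>)))) \<le> exp (2 * norm s)"
      proof -
        have "norm (Ln (1 + t * \<alpha>) + Ln (1 + t * cnj \<alpha>)) \<le> 2"
          using norm_triangle_ineq[of "Ln (1 + t * \<alpha>)" "Ln (1 + t * cnj \<alpha>)"]
            norm_Ln_le[OF small[OF t]] norm_Ln_le[OF small'[OF t]] small[OF t] small'[OF t]
          by linarith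
        then have "norm (- s * (Ln (1 + t * \<alpha>) + Ln (1 + t * cnj \<alpha>))) \<le> norm s * 2"
          unfolding norm_mult norm_minus_cancel by (rule mult_left_mono) simp
        then show ?thesis
          using norm_exp[of "- s * (Ln (1 + t * \<alpha>) + Ln (1 + t * cnj \<alpha>))"]
          by (smt (verit) exp_le_cancel_iff mult.commute)
      qed
      have 3: "norm (complex_of_real (cmod w) powr (- 2 * s)) = norm w powr (- 2 * Re s)"
        by (subst norm_powr_real_powr) auto
      have "norm (f t) \<le> (norm w * 2) ^ a * norm w powr (- 2 * Re s) * exp (2 * norm s)"
        unfolding f_def norm_mult[of "_ * _ powr _"] norm_mult[of "_ ^ a"] 3
        by (intro mult_mono 1 2) auto
      then show ?thesis
        by (simp add: power_mult_distrib mult_ac)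
    qed
    show "f (of_nat j) = kronecker_term a s (w + of_nat j * h)" if "j \<le> n" for j
    proof -
      define z where "z = 1 + of_nat j * \<alpha>"
      have "real j * (2 * norm h) < norm w"
      proof -
        have "real j * (2 * norm h) < 8 * real (n + 1) * norm h"
          using that h by (simp add: mult_less_cancel_right_pos flip: mult.assoc)
        then show ?thesis using w by linarith
      qed
      then have j: "of_nat j \<in> ball (0 :: complex) (norm w / (2 * norm h))"
        using h by (simp add: field_simps)
      have z: "z \<notin> \<real>\<^sub>\<le>\<^sub>0"
        unfolding z_def using not_neg small[OF j] by blast
      then have "z \<noteq> 0" by auto
      have wz: "w + of_nat j * h = w * z"
        by (simp add: z_def \<alpha>_def field_simps)
      \<comment> \<open>Off the nonpositive real axis \<open>Ln\<close> commutes with conjugation,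
        so the two logarithms add up to 2 ln |z| with no multiple of 2\<pi>i.\<close>
      have "Ln z + Ln (cnj z) = Ln z + cnj (Ln z)"
        using z by (simp add: cnj_Ln)
      also have "\<dots> = 2 * of_real (ln (cmod z))"
        using \<open>z \<noteq> 0\<close> by (simp add: complex_add_cnj)
      also have "\<dots> = 2 * Ln (of_real (cmod z))"
        using \<open>z \<noteq> 0\<close> by (simp add: Ln_of_real)
      finally have "exp (- s * (Ln z + Ln (cnj z))) = of_real (cmod z) powr (- 2 * s)"
        using \<open>z \<noteq> 0\<close> by (simp add: powr_def mult_ac)
      moreover have "complex_of_real (cmod (w * z)) powr (- 2 * s) =
          of_real (cmod w) powr (- 2 * s) * of_real (cmod z) powr (- 2 * s)"
        unfolding norm_mult of_real_mult by (rule powr_times_real) auto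
      moreover have "1 + of_nat j * cnj \<alpha> = cnj z"
        by (simp add: z_def)
      ultimately show ?thesis
        unfolding wz by (simp add: f_def kronecker_term_def flip: z_def)
    qed
  qed
  also have "\<dots> = 2 ^ a * exp (2 * norm s) * (4 * real (n + 1) * norm h) ^ n
      * (norm w powr real a * norm w powr (- 2 * Re s) * norm w powr (- real n))"
    unfolding power_divide using w0 by (simp add: powr_minus powr_realpow divide_inverse)
  also have "norm w powr real a * norm w powr (- 2 * Re s) * norm w powr (- real n) =
      norm w powr (real a - 2 * Re s - real n)"
    by (simp flip: powr_add)
  finally show ?thesis .
qed

context lattice_character
begin

lemma diff_summable_kronecker_term:
  assumes "Re s > 1 + real a / 2 - real N / 2"
  shows "diff_summable N (kronecker_term a s)"
  unfolding diff_summable_def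
proof (rule summable_on_L_if_bounded)
  show "2 * Re s + real N - real a > 2"
    using assms by (simp add: field_simps)
  show "norm ((fdiff h ^^ N) (kronecker_term a s) w) \<le>
      2 ^ a * exp (2 * norm s) * (4 * real (N + 1) * norm h) ^ N
        * norm w powr (- (2 * Re s + real N - real a))"
    if "8 * real (N + 1) * norm h \<le> norm w" for w
    using norm_fdiff_kronecker_term_le[OF h_nonzero that, of a s]
    by (simp add: algebra_simps)
qed

lemma holomorphic_twisted_sum_kronecker_term:
  "(\<lambda>s. twisted_sum N (kronecker_term a s)) holomorphic_on {s. Re s > 1 + real a / 2 - real N / 2}"
proof (rule holomorphic_on_twisted_sum)
  show "open {s. Re s > 1 + real a / 2 - real N / 2}"
    by (rule open_halfspace_Re_gt)
  show "(\<lambda>s. kronecker_term a s w) holomorphic_on {s. Re s > 1 + real a / 2 - real N / 2}" for w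
  proof (cases "w = 0")
    case False
    then show ?thesis
      unfolding kronecker_term_def by (intro holomorphic_intros) auto
  qed simp
  fix v assume "v \<in> {s. Re s > 1 + real a / 2 - real N / 2}"
  then have v: "Re v > 1 + real a / 2 - real N / 2" by simp
  \<comment> \<open>Half the distance from v to the boundary line: on the disc of radius e the decay
    exponent stays at least q, and q > 2.\<close>
  define e where "e = (Re v - (1 + real a / 2 - real N / 2)) / 2"
  have e: "e > 0" using v by (simp add: e_def)
  define q where "q = 2 * (Re v - e) + real N - real a"
  have q: "q > 2" using v by (simp add: q_def e_def field_simps)
  define C where "C = 2 ^ a * exp (2 * (norm v + e)) * (4 * real (N + 1) * norm h) ^ N"
  \<comment> \<open>The bound \<open>1 \<le> norm w\<close> makes powers monotone in the exponent,
    so one estimate serves all s in the disc.\<close>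
  have "norm ((fdiff h ^^ N) (kronecker_term a s) w) \<le> C * norm w powr (- q)"
    if s: "s \<in> ball v e" and w: "max 1 (8 * real (N + 1) * norm h) \<le> norm w" for s w
  proof -
    have "norm (s - v) < e" using s by (simp add: dist_norm norm_minus_commute)
    then have "norm s \<le> norm v + e"
      using norm_triangle_ineq2[of s v] by simp
    moreover have "Re s \<ge> Re v - e"
      using abs_Re_le_cmod[of "s - v"] \<open>norm (s - v) < e\<close> by simp
    ultimately have "2 ^ a * exp (2 * norm s) * (4 * real (N + 1) * norm h) ^ N
        * norm w powr (real a - 2 * Re s - real N) \<le> C * norm w powr (- q)"
      unfolding C_def q_def using w by (intro mult_mono powr_mono) auto
    then show ?thesis
      using norm_fdiff_kronecker_term_le[OF h_nonzero, of N w a s] w by simp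
  qed
  then show "\<exists>e>0. \<exists>q>2. \<exists>C R. \<forall>s\<in>ball v e. \<forall>w\<in>L. R \<le> norm w \<longrightarrow>
      norm ((fdiff h ^^ N) (kronecker_term a s) w) \<le> C * norm w powr (- q)"
    using e q by blast
qed

text \<open>The half-planes exhaust the plane. A level chosen separately for each s gives on each
  half-plane the value of the fixed level N, because the value does not depend on the level; so the
  glued function is holomorphic everywhere.\<close>

lemma entire_twisted_sum_kronecker_term:
  obtains F where "F holomorphic_on UNIV"
    and "\<And>N s. Re s > 1 + real a / 2 - real N / 2 \<Longrightarrow> F s = twisted_sum N (kronecker_term a s)"
proof -
  define lvl where "lvl = (\<lambda>s. SOME N. Re s > 1 + real a / 2 - real N / 2)"
  define F where "F = (\<lambda>s. twisted_sum (lvl s) (kronecker_term a s))"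
  have ex: "\<exists>N. Re s > 1 + real a / 2 - real N / 2" for s
  proof -
    obtain N :: nat where "2 + real a - 2 * Re s < real N"
      using reals_Archimedean2 by blast
    then show ?thesis by (intro exI[of _ N]) (simp add: field_simps)
  qed
  have lvl: "Re s > 1 + real a / 2 - real (lvl s) / 2" for s
    unfolding lvl_def by (rule someI_ex[OF ex])
  have F: "F s = twisted_sum N (kronecker_term a s)"
    if "Re s > 1 + real a / 2 - real N / 2" for N s
    using twisted_sum_mono[OF diff_summable_kronecker_term[OF that], of "lvl s"]
      twisted_sum_mono[OF diff_summable_kronecker_term[OF lvl], of s N]
    unfolding F_def by (metis nat_le_linear)
  have "F field_differentiable (at s)" for s
  proof -
    obtain N where N: "Re s > 1 + real a / 2 - real N / 2"
      using ex by blast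
    have "F holomorphic_on {s. Re s > 1 + real a / 2 - real N / 2}"
      by (rule holomorphic_transform[OF holomorphic_twisted_sum_kronecker_term]) (use F in auto)
    then show ?thesis
      using N by (auto simp: holomorphic_on_def
          at_within_open[OF _ open_halfspace_Re_gt[of "1 + real a / 2 - real N / 2"]])
  qed
  then have "F holomorphic_on UNIV"
    by (simp add: holomorphic_on_def)
  then show ?thesis
    using F that by blast
qed

lemma kronecker_series_eq_twisted_sum:
  assumes "\<And>w. w \<in> L \<Longrightarrow> \<psi> w = lattice_char \<tau> x w"
  shows "kronecker_series a x s \<tau> = twisted_sum 0 (kronecker_term a s)"
proof -
  have "kronecker_series a x s \<tau> = (\<Sum>\<^sub>\<infinity>w\<in>L. \<psi> w * kronecker_term a s w)"
    unfolding kronecker_series_def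
    by (rule infsum_cong_neutral) (auto simp: kronecker_term_def assms mult.assoc)
  then show ?thesis by (simp add: twisted_sum_def)
qed

lemma kronecker_K_eq_twisted_sum:
  assumes \<psi>: "\<And>w. w \<in> L \<Longrightarrow> \<psi> w = lattice_char \<tau> x w"
    and "Re s > 1 + real a / 2 - real N / 2"
  shows "kronecker_K a x s \<tau> = twisted_sum N (kronecker_term a s)"
proof -
  obtain F where F: "F holomorphic_on UNIV"
    "\<And>N s. Re s > 1 + real a / 2 - real N / 2 \<Longrightarrow> F s = twisted_sum N (kronecker_term a s)"
    using entire_twisted_sum_kronecker_term by blast
  have "kronecker_K a x s \<tau> = F s"
    by (rule kronecker_K_eqI[OF F(1)]) (simp add: kronecker_series_eq_twisted_sum[OF \<psi>] F(2)[where N = 0])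
  then show ?thesis
    using F(2) assms(2) by simp
qed

text \<open>The substitution of -w for w acts on the series, and uniqueness of the continuation
  carries the sign to all s. The character of - x thus requires no continuation of its own.\<close>

lemma kronecker_K_uminus:
  assumes \<psi>: "\<And>w. w \<in> L \<Longrightarrow> \<psi> w = lattice_char \<tau> x w"
  shows "kronecker_K a (- x) s \<tau> = (- 1) ^ a * kronecker_K a x s \<tau>"
proof -
  obtain F where F: "F holomorphic_on UNIV"
    "\<And>N s. Re s > 1 + real a / 2 - real N / 2 \<Longrightarrow> F s = twisted_sum N (kronecker_term a s)"
    using entire_twisted_sum_kronecker_term by blast
  have bij: "bij_betw uminus (L - {0}) (L - {0})"
    by (rule bij_betwI[where g = uminus]) auto
  have series: "kronecker_series a (- x) s \<tau> = (- 1) ^ a * kronecker_series a x s \<tau>" for s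
  proof -
    have "kronecker_series a (- x) s \<tau> = (\<Sum>\<^sub>\<infinity>w\<in>L - {0}.
        lattice_char \<tau> (- x) (- w) * cnj (- w) ^ a * of_real (cmod (- w)) powr (- 2 * s))"
      unfolding kronecker_series_def by (rule infsum_reindex_bij_betw[OF bij, symmetric])
    also have "\<dots> = (\<Sum>\<^sub>\<infinity>w\<in>L - {0}.
        (- 1) ^ a * (lattice_char \<tau> x w * cnj w ^ a * of_real (cmod w) powr (- 2 * s)))"
      by (rule infsum_cong) (simp add: lattice_char_def power_minus[of "cnj _"])
    finally show ?thesis
      by (simp add: kronecker_series_def infsum_cmult_right')
  qed
  have "kronecker_K a (- x) s \<tau> = (- 1) ^ a * F s"
    by (rule kronecker_K_eqI[where F = "\<lambda>s. (- 1) ^ a * F s"])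
      (auto intro!: holomorphic_intros F(1)
        simp: series kronecker_series_eq_twisted_sum[OF \<psi>] F(2)[where N = 0])
  moreover have "kronecker_K a x s \<tau> = F s"
    by (rule kronecker_K_eqI[OF F(1)]) (simp add: kronecker_series_eq_twisted_sum[OF \<psi>] F(2)[where N = 0])
  ultimately show ?thesis by simp
qed

end

section \<open>The Kronecker function\<close>

context lattice
begin

lemma exists_L_near: "\<exists>v\<in>L. norm (u - v) \<le> 1 + norm \<tau>"
proof -
  define y where "y = Im u / Im \<tau>"
  define x where "x = Re u - y * Re \<tau>"
  have u: "u = of_real x + of_real y * \<tau>"
    using Im_pos by (simp add: complex_eq_iff x_def y_def)
  define v where "v = of_int \<lfloor>x\<rfloor> + of_int \<lfloor>y\<rfloor> * \<tau>"
  have "u - v = of_real (frac x) + of_real (frac y) * \<tau>"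
    by (simp add: u v_def frac_def algebra_simps)
  then have "norm (u - v) \<le> frac x + frac y * norm \<tau>"
    using norm_triangle_ineq[of "of_real (frac x)" "of_real (frac y) * \<tau>"]
    by (simp add: norm_mult frac_ge_0)
  also have "\<dots> \<le> 1 + 1 * norm \<tau>"
    by (intro add_mono mult_right_mono less_imp_le[OF frac_lt_1]) auto
  finally have "norm (u - v) \<le> 1 + norm \<tau>" by simp
  moreover have "v \<in> L" unfolding v_def period_lattice_def by blast
  ultimately show ?thesis by blast
qed

lemma notin_L_ball: "u \<in> ball 0 (1 / coord_bound) - {0} \<Longrightarrow> u \<notin> L"
  using norm_L_ge[of u] coord_bound_ge_1 by (auto simp: field_simps)

end

context lattice_character
begin

text \<open>The nontrivial multiplier rules out the nonzero constants that Liouville's theorem leaves.\<close>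

lemma quasi_periodic_eq_0:
  assumes G: "G holomorphic_on - L" and shift: "\<And>u v. u \<notin> L \<Longrightarrow> v \<in> L \<Longrightarrow> G (u + v) = G u / \<psi> v"
    and g: "g holomorphic_on ball 0 (1 / coord_bound)"
    and Gg: "\<And>u. u \<in> ball 0 (1 / coord_bound) - {0} \<Longrightarrow> G u = g u"
    and u: "u \<in> ball 0 (1 / coord_bound)"
  shows "g u = 0"
proof -
  \<comment> \<open>The value at a lattice point is forced by g 0 and the multiplier. With it
    \<open>H\<close> has the multiplier everywhere, and its holomorphy at 0 is transported to all of
    L.\<close>
  define H where "H = (\<lambda>u. if u \<in> L then g 0 / \<psi> u else G u)"
  have H_shift: "H (u + v) = H u / \<psi> v" if "v \<in> L" for u v
    using that by (simp add: H_def add_in_L_iff shift psi_add)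
  have Hg: "H u = g u" if "u \<in> ball 0 (1 / coord_bound)" for u
    using that notin_L_ball[of u] Gg[of u] by (cases "u = 0") (auto simp: H_def psi_0)
  have "H field_differentiable (at u)" for u
  proof (cases "u \<in> L")
    case True
    have "H holomorphic_on ball 0 (1 / coord_bound)"
      by (rule holomorphic_transform[OF g]) (simp add: Hg)
    then have "H field_differentiable (at 0)"
      using coord_bound_ge_1 by (simp add: holomorphic_on_def at_within_open[where S = "ball 0 _"])
    then obtain d where "(H has_field_derivative d) (at 0)"
      by (auto simp: field_differentiable_def)
    then have "((\<lambda>w. H w / \<psi> u) has_field_derivative d / \<psi> u) (at 0)"
      by (rule DERIV_cdivide)
    then have "((\<lambda>w. H (w + u)) has_field_derivative d / \<psi> u) (at 0)"
      by (simp add: H_shift[OF True])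
    then have "(H has_field_derivative d / \<psi> u) (at (0 + u))"
      by (subst DERIV_shift)
    then show ?thesis
      by (auto simp: field_differentiable_def)
  next
    case False
    have "H holomorphic_on - L"
      by (rule holomorphic_transform[OF G]) (simp add: H_def)
    then show ?thesis
      using False closed_L by (simp add: holomorphic_on_def at_within_open[where S = "- L"] open_Compl)
  qed
  then have H_hol: "H holomorphic_on UNIV"
    by (simp add: holomorphic_on_def)
  have "compact (H ` cball 0 (1 + norm \<tau>))"
    by (intro compact_continuous_image holomorphic_on_imp_continuous_on compact_cball
        holomorphic_on_subset[OF H_hol]) auto
  then obtain B where B: "\<And>u. u \<in> cball 0 (1 + norm \<tau>) \<Longrightarrow> norm (H u) \<le> B"
    using compact_imp_bounded by (force simp: bounded_iff)
  \<comment> \<open>A unitary multiplier makes the norm periodic, so the maximum over a disc that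
    meets every class modulo L is a global bound.\<close>
  have "norm (H u) \<le> B" for u
  proof -
    obtain v where v: "v \<in> L" "norm (u - v) \<le> 1 + norm \<tau>"
      using exists_L_near by blast
    have "H u = H (u - v) / \<psi> v"
      using H_shift[OF v(1), of "u - v"] by simp
    then show ?thesis
      using B[of "u - v"] v by (simp add: norm_divide norm_psi)
  qed
  then have "bounded (range H)"
    by (auto simp: bounded_iff)
  then obtain c where c: "\<And>u. H u = c"
    using Liouville_theorem[OF H_hol] by (auto simp: constant_on_def)
  have "c = c / \<psi> h"
    using H_shift[OF h_in_L, of 0] c by simp
  then have "c = 0"
    using psi_h psi_nonzero[OF h_in_L] by (auto simp: field_simps)
  then show ?thesis
    using Hg[OF u] c by simp
qed

text \<open>L is closed under steps by h, so differencing at points of L never looks outside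
  L.\<close>

lemma twisted_sum_cong:
  assumes "\<And>w. w \<in> L \<Longrightarrow> f w = g w"
  shows "twisted_sum N f = twisted_sum N g"
proof -
  show ?thesis
    unfolding twisted_sum_def
    by (intro arg_cong2[where f = "(/)"] infsum_cong arg_cong2[where f = "(*)"] refl fdiff_funpow_eq)
      (simp add: assms add_in_L of_nat_mult_h_in_L)
qed

text \<open>Under \<open>inverse 0 = 0\<close> the powers of \<open>inverse w\<close> vanish at w =
  0, so the pole 1/u of the Kronecker function needs a summand of its own, supported at w =
  0.\<close>

lemma twisted_sum_indicator:
  "diff_summable 0 (\<lambda>w. if w = 0 then c else 0)"
  "twisted_sum 0 (\<lambda>w. if w = 0 then c else 0) = c"
proof -
  have "(\<lambda>w :: complex. norm (if w = 0 then c else 0)) summable_on L \<longleftrightarrow>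
      (\<lambda>w :: complex. norm (if w = 0 then c else 0)) summable_on {0}"
    by (rule summable_on_cong_neutral) auto
  then show "diff_summable 0 (\<lambda>w. if w = 0 then c else 0)"
    by (simp add: diff_summable_def)
  have "(\<Sum>\<^sub>\<infinity>w\<in>L. \<psi> w * (if w = 0 then c else 0)) = (\<Sum>\<^sub>\<infinity>w\<in>{0}. \<psi> w * (if w = 0 then c else 0))"
    by (rule infsum_cong_neutral) auto
  then show "twisted_sum 0 (\<lambda>w. if w = 0 then c else 0) = c"
    by (simp add: twisted_sum_def psi_0)
qed

text \<open>Two differences leave decay |w|^(-k-2), which is absolutely summable for every k \<ge>
  1, so one level serves e_1, e_2 and e_3 at once.\<close>

definition twisted_eisenstein :: "nat \<Rightarrow> complex" where
  "twisted_eisenstein k = twisted_sum 2 (\<lambda>w. inverse w ^ k)"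

text \<open>Up to an exponential factor this is Kronecker's quotient \<theta>'(0)\<theta>(u + \<xi>)
  / (\<theta>(u)\<theta>(\<xi>)), normalised to have a unitary multiplier. Defined as a sum, it
  shows its multiplier, its poles and its expansion directly.\<close>

definition kronecker_fun :: "complex \<Rightarrow> complex" where
  "kronecker_fun u = twisted_sum 2 (\<lambda>w. inverse (w + u))"

text \<open>For w \<noteq> 0, 1/(w + u) = 1/w - u/w^2 + u^2/w^3 - u^3/(w^3(w + u)). The last term
  decays like |w|^(-4), so level 0 is enough; at w = 0 it is 0 by \<open>inverse 0 = 0\<close>, so
  no pole at u = 0 arises.\<close>

definition kronecker_rem :: "complex \<Rightarrow> complex" where
  "kronecker_rem u = - twisted_sum 0 (\<lambda>w. inverse (w ^ 3 * (w + u)))"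

lemma diff_summable_inverse_power:
  assumes "k > 0"
  shows "diff_summable 2 (\<lambda>w. inverse w ^ k)"
proof -
  have "kronecker_term k (of_nat k) = (\<lambda>w. inverse w ^ k)"
    using kronecker_term_nat[OF assms] by blast
  then show ?thesis
    using diff_summable_kronecker_term[where a = k and s = "of_nat k" and N = 2] assms by simp
qed

lemma kronecker_K_eq_twisted_eisenstein:
  assumes "\<And>w. w \<in> L \<Longrightarrow> \<psi> w = lattice_char \<tau> x w" "k > 0"
  shows "kronecker_K k x (of_nat k) \<tau> = twisted_eisenstein k"
proof -
  have "kronecker_term k (of_nat k) = (\<lambda>w. inverse w ^ k)"
    using kronecker_term_nat[OF assms(2)] by blast
  then show ?thesis
    using kronecker_K_eq_twisted_sum[OF assms(1), where a = k and s = "of_nat k" and N = 2] assms(2)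
    by (simp add: twisted_eisenstein_def)
qed

lemma kronecker_fun_shift: "v \<in> L \<Longrightarrow> kronecker_fun (u + v) = kronecker_fun u / \<psi> v"
  using twisted_sum_shift[of v 2 "\<lambda>w. inverse (w + u)"] by (simp add: kronecker_fun_def add_ac)

text \<open>On the disc of the difference estimate |th| < |w|/2, and |u| \<le> |w|/4, so |w + th +
  u| \<ge> |w|/4. This gives the bound 4/|w| and the constant 4 * 12^2 = 576; the 24 is 8(n + 1) for
  n = 2.\<close>

lemma norm_fdiff_inverse_le:
  assumes w: "24 * norm h \<le> norm w" and u: "4 * norm u \<le> norm w"
  shows "norm ((fdiff h ^^ 2) (\<lambda>w. inverse (w + u)) w) \<le> 576 * norm h ^ 2 * norm w powr (- 3)"
proof -
  have h: "norm h > 0" using h_nonzero by simp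
  have w0: "norm w > 0"
    by (rule less_le_trans[OF _ w]) (use h in simp)
  define f where "f = (\<lambda>t. inverse (w + t * h + u))"
  have ge: "norm w / 4 \<le> norm (w + t * h + u)" if "t \<in> ball 0 (norm w / (2 * norm h))" for t
  proof -
    have "norm (t * h) < norm w / 2"
      using that h by (simp add: norm_mult field_simps)
    moreover have "norm w \<le> norm (w + t * h + u) + norm (t * h) + norm u"
      using norm_triangle_ineq4[of "w + t * h + u" "t * h + u"] norm_triangle_ineq[of "t * h" u]
      by simp
    ultimately show ?thesis using u by linarith
  qed
  have "norm ((fdiff h ^^ 2) (\<lambda>w. inverse (w + u)) w) \<le> 4 / norm w * (4 * real (2 + 1) * norm h / norm w) ^ 2"
  proof (rule norm_fdiff_funpow_le[OF h_nonzero, of 2 w f])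
    show "f holomorphic_on ball 0 (norm w / (2 * norm h))"
      unfolding f_def using ge w0 by (intro holomorphic_intros) force
    show "norm (f t) \<le> 4 / norm w" if "t \<in> ball 0 (norm w / (2 * norm h))" for t
      using le_imp_inverse_le[OF ge[OF that]] w0 by (simp add: f_def norm_inverse)
  qed (use w in \<open>simp_all add: f_def\<close>)
  also have "\<dots> = 576 * norm h ^ 2 * norm w powr (- 3)"
    using w0 by (simp add: powr_minus powr_numeral power2_eq_square power3_eq_cube field_simps)
  finally show ?thesis .
qed

lemma holomorphic_kronecker_fun: "kronecker_fun holomorphic_on - L"
proof -
  have "(\<lambda>u. twisted_sum 2 (\<lambda>w. inverse (w + u))) holomorphic_on - L"
  proof (rule holomorphic_on_twisted_sum)
    show "open (- L)"
      using closed_L by (simp add: open_Compl)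
    show "(\<lambda>u. inverse (w + u)) holomorphic_on - L" if "w \<in> L" for w
      using minus_in_L[OF that] by (intro holomorphic_intros) (auto simp: add_eq_0_iff)
    fix v
    have "norm ((fdiff h ^^ 2) (\<lambda>w. inverse (w + u)) w) \<le> 576 * norm h ^ 2 * norm w powr (- 3)"
      if "u \<in> ball v 1" "max (24 * norm h) (4 * (norm v + 1)) \<le> norm w" for u w :: complex
    proof (rule norm_fdiff_inverse_le)
      have "norm u \<le> norm v + 1"
        using that(1) norm_triangle_ineq2[of u v] by (simp add: dist_norm norm_minus_commute)
      then show "4 * norm u \<le> norm w" using that(2) by simp
    qed (use that(2) in simp)
    moreover have "0 < (1 :: real)" "2 < (3 :: real)" by simp_all
    ultimately show "\<exists>e>0. \<exists>q>2. \<exists>C R. \<forall>u\<in>ball v e. \<forall>w\<in>L. R \<le> norm w \<longrightarrow>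
        norm ((fdiff h ^^ 2) (\<lambda>w. inverse (w + u)) w) \<le> C * norm w powr (- q)"
      by blast
  qed
  then show ?thesis
    by (simp add: kronecker_fun_def[abs_def])
qed

section \<open>Remainder term and expansion at the origin\<close>

lemma norm_rem_term_le:
  fixes u w :: complex
  assumes "1 \<le> norm w" "2 * norm u \<le> norm w"
  shows "norm (inverse (w ^ 3 * (w + u))) \<le> 2 * norm w powr (- 4)"
proof -
  have w0: "norm w > 0" using assms by linarith
  have "norm w / 2 \<le> norm (w + u)"
    using assms norm_triangle_ineq4[of "w + u" u] by simp
  then have "norm w ^ 3 * (norm w / 2) \<le> norm (w ^ 3 * (w + u))"
    unfolding norm_mult norm_power by (rule mult_left_mono) simp
  then have "inverse (norm (w ^ 3 * (w + u))) \<le> inverse (norm w ^ 3 * (norm w / 2))"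
    using w0 by (intro le_imp_inverse_le mult_pos_pos zero_less_power) auto
  also have "\<dots> = 2 * norm w powr (- 4)"
    using assms by (simp add: powr_minus powr_numeral field_simps power4_eq_xxxx power3_eq_cube)
  finally show ?thesis by (simp only: norm_inverse)
qed

lemma diff_summable_rem: "diff_summable 0 (\<lambda>w. inverse (w ^ 3 * (w + u)))"
  unfolding diff_summable_def
  by (rule summable_on_L_if_bounded[where q = 4 and C = 2 and R = "max 1 (2 * norm u)"])
    (use norm_rem_term_le in auto)

lemma holomorphic_kronecker_rem: "kronecker_rem holomorphic_on ball 0 (1 / coord_bound)"
proof -
  have "(\<lambda>u. twisted_sum 0 (\<lambda>w. inverse (w ^ 3 * (w + u)))) holomorphic_on ball 0 (1 / coord_bound)"
  proof (rule holomorphic_on_twisted_sum)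
    show "(\<lambda>u. inverse (w ^ 3 * (w + u))) holomorphic_on ball 0 (1 / coord_bound)" if "w \<in> L" for w
    proof (cases "w = 0")
      case False
      have "w + u \<noteq> 0" if "u \<in> ball 0 (1 / coord_bound)" for u
      proof
        assume "w + u = 0"
        then have "u = - w" by (simp add: add_eq_0_iff)
        then show False
          using notin_L_ball[of u] that False \<open>w \<in> L\<close> by simp
      qed
      with False show ?thesis
        by (intro holomorphic_intros) auto
    qed simp
    fix v
    have "norm (inverse (w ^ 3 * (w + u))) \<le> 2 * norm w powr (- 4)"
      if "u \<in> ball v 1" "max 1 (2 * (norm v + 1)) \<le> norm w" for u w :: complex
    proof (rule norm_rem_term_le)
      have "norm u \<le> norm v + 1"
        using that(1) norm_triangle_ineq2[of u v] by (simp add: dist_norm norm_minus_commute)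
      then show "2 * norm u \<le> norm w" using that(2) by simp
      show "1 \<le> norm w" using that(2) by linarith
    qed
    moreover have "0 < (1 :: real)" "2 < (4 :: real)" by simp_all
    ultimately show "\<exists>e>0. \<exists>q>2. \<exists>C R. \<forall>u\<in>ball v e. \<forall>w\<in>L. R \<le> norm w \<longrightarrow>
        norm ((fdiff h ^^ 0) (\<lambda>w. inverse (w ^ 3 * (w + u))) w) \<le> C * norm w powr (- q)"
      unfolding funpow_0
      by blast
  qed simp
  then show ?thesis
    unfolding kronecker_rem_def[abs_def] by (rule holomorphic_on_minus)
qed

text \<open>The expansion is applied term by term. Additivity of \<open>twisted_sum\<close> wants a
  common level, so the indicator of w = 0 and the remainder, both summable at level 0, are lifted to
  level 2.\<close>

lemma kronecker_fun_expansion: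
  assumes u: "u \<in> ball 0 (1 / coord_bound) - {0}"
  shows "kronecker_fun u = inverse u + twisted_eisenstein 1 - u * twisted_eisenstein 2
           + u ^ 2 * twisted_eisenstein 3 + u ^ 3 * kronecker_rem u"
proof -
  define f where "f = (\<lambda>k w :: complex. inverse w ^ k)"
  define r where "r = (\<lambda>w. inverse (w ^ 3 * (w + u)))"
  define d where "d = (\<lambda>w :: complex. if w = 0 then inverse u else 0)"
  have f: "diff_summable 2 (f k)" if "k > 0" for k
    using diff_summable_inverse_power[OF that] by (simp add: f_def)
  have f_sum: "twisted_sum 2 (f k) = twisted_eisenstein k" for k
    by (simp add: f_def twisted_eisenstein_def)
  have r: "diff_summable 2 r" "twisted_sum 2 r = - kronecker_rem u"
    using twisted_sum_mono[OF diff_summable_rem, of 2 u] by (simp_all add: r_def kronecker_rem_def)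
  have d: "diff_summable 2 d" "twisted_sum 2 d = inverse u"
    using twisted_sum_mono[OF twisted_sum_indicator(1), of 2 "inverse u"]
    by (simp_all add: d_def twisted_sum_indicator(2))
  have s3: "diff_summable 2 (\<lambda>w. u ^ 2 * f 3 w + (- (u ^ 3)) * r w)"
    by (intro twisted_sum_add(1) twisted_sum_cmult(1) f r(1)) simp
  have s2: "diff_summable 2 (\<lambda>w. (- u) * f 2 w + (u ^ 2 * f 3 w + (- (u ^ 3)) * r w))"
    by (intro twisted_sum_add(1) twisted_sum_cmult(1) f r(1)) simp_all
  have s1: "diff_summable 2 (\<lambda>w. f 1 w + ((- u) * f 2 w + (u ^ 2 * f 3 w + (- (u ^ 3)) * r w)))"
    by (intro twisted_sum_add(1) twisted_sum_cmult(1) f r(1)) simp_all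
  have "kronecker_fun u =
      twisted_sum 2 (\<lambda>w. d w + (f 1 w + ((- u) * f 2 w + (u ^ 2 * f 3 w + (- (u ^ 3)) * r w))))"
    unfolding kronecker_fun_def
  proof (rule twisted_sum_cong)
    fix w assume "w \<in> L"
    show "inverse (w + u) = d w + (f 1 w + ((- u) * f 2 w + (u ^ 2 * f 3 w + (- (u ^ 3)) * r w)))"
    proof (cases "w = 0")
      case False
      have "u \<noteq> - w"
        using notin_L_ball[OF u] \<open>w \<in> L\<close> by auto
      then have "w + u \<noteq> 0" by (simp add: add_eq_0_iff)
      with False show ?thesis
        by (simp add: d_def f_def r_def divide_simps) algebra
    qed (simp add: d_def f_def r_def)
  qed
  also have "\<dots> = inverse u + (twisted_eisenstein 1 + ((- u) * twisted_eisenstein 2 +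
      (u ^ 2 * twisted_eisenstein 3 + (- (u ^ 3)) * (- kronecker_rem u))))"
    by (simp only: twisted_sum_add(2)[OF d(1) s1] twisted_sum_add(2)[OF f s2]
        twisted_sum_add(2)[OF twisted_sum_cmult(1)[OF f] s3] zero_less_numeral zero_less_one
        twisted_sum_add(2)[OF twisted_sum_cmult(1)[OF f] twisted_sum_cmult(1)[OF r(1)]]
        twisted_sum_cmult(2) d(2) r(2) f_sum)
  finally show ?thesis by simp
qed

lemma deriv_kronecker_fun_shift:
  assumes "u \<notin> L" "v \<in> L"
  shows "deriv kronecker_fun (u + v) = deriv kronecker_fun u / \<psi> v"
proof -
  have "open (- L)" using closed_L by (simp add: open_Compl)
  then have "(kronecker_fun has_field_derivative deriv kronecker_fun u) (at u)"
    using assms by (intro holomorphic_derivI[OF holomorphic_kronecker_fun]) auto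
  then have "((\<lambda>w. kronecker_fun w / \<psi> v) has_field_derivative deriv kronecker_fun u / \<psi> v) (at u)"
    by (rule DERIV_cdivide)
  then have "((\<lambda>w. kronecker_fun (w + v)) has_field_derivative deriv kronecker_fun u / \<psi> v) (at u)"
    by (simp add: kronecker_fun_shift[OF assms(2)])
  then have "(kronecker_fun has_field_derivative deriv kronecker_fun u / \<psi> v) (at (u + v))"
    by (subst DERIV_shift)
  then show ?thesis by (rule DERIV_imp_deriv)
qed

end

section \<open>The relation between twisted Eisenstein numbers\<close>

context lattice_character
begin

text \<open>\<open>kronecker_reg\<close> is the Kronecker function without its pole,
  \<open>kronecker_quot\<close> is (kronecker_reg u - e_1) / u, and \<open>kronecker_reg'\<close> is
  the derivative of \<open>kronecker_reg\<close>. They are written out so as to make sense at u = 0,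
  where values and derivatives are read off.\<close>

definition kronecker_reg :: "complex \<Rightarrow> complex" where
  "kronecker_reg u = twisted_eisenstein 1 - u * twisted_eisenstein 2
     + u ^ 2 * twisted_eisenstein 3 + u ^ 3 * kronecker_rem u"

definition kronecker_quot :: "complex \<Rightarrow> complex" where
  "kronecker_quot u = - twisted_eisenstein 2 + u * twisted_eisenstein 3 + u ^ 2 * kronecker_rem u"

definition kronecker_reg' :: "complex \<Rightarrow> complex" where
  "kronecker_reg' u = - twisted_eisenstein 2 + 2 * u * twisted_eisenstein 3
     + 3 * u ^ 2 * kronecker_rem u + u ^ 3 * deriv kronecker_rem u"

lemma kronecker_fun_eq:
  "u \<in> ball 0 (1 / coord_bound) - {0} \<Longrightarrow> kronecker_fun u = inverse u + kronecker_reg u"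
  by (simp add: kronecker_fun_expansion kronecker_reg_def)

lemma kronecker_reg_eq: "kronecker_reg u = twisted_eisenstein 1 + u * kronecker_quot u"
  by (simp add: kronecker_reg_def kronecker_quot_def algebra_simps power2_eq_square power3_eq_cube)

lemma holomorphic_deriv_kronecker_rem: "deriv kronecker_rem holomorphic_on ball 0 (1 / coord_bound)"
  by (intro holomorphic_deriv holomorphic_kronecker_rem) auto

lemma holomorphic_kronecker_parts:
  "kronecker_reg holomorphic_on ball 0 (1 / coord_bound)"
  "kronecker_quot holomorphic_on ball 0 (1 / coord_bound)"
  "kronecker_reg' holomorphic_on ball 0 (1 / coord_bound)"
  unfolding kronecker_reg_def[abs_def] kronecker_quot_def[abs_def] kronecker_reg'_def[abs_def]
  by (intro holomorphic_intros holomorphic_kronecker_rem holomorphic_deriv_kronecker_rem)+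

lemma zero_in_ball: "0 \<in> ball 0 (1 / coord_bound)"
  using coord_bound_ge_1 by simp

lemma kronecker_parts_0:
  "kronecker_reg 0 = twisted_eisenstein 1" "kronecker_quot 0 = - twisted_eisenstein 2"
  "kronecker_reg' 0 = - twisted_eisenstein 2"
  by (simp_all add: kronecker_reg_def kronecker_quot_def kronecker_reg'_def)

lemma kronecker_parts_deriv_0:
  "(kronecker_reg has_field_derivative - twisted_eisenstein 2) (at 0)"
  "(kronecker_quot has_field_derivative twisted_eisenstein 3) (at 0)"
  "(kronecker_reg' has_field_derivative 2 * twisted_eisenstein 3) (at 0)"
proof -
  have rem: "(kronecker_rem has_field_derivative deriv kronecker_rem 0) (at 0)"
    by (rule holomorphic_derivI[OF holomorphic_kronecker_rem _ zero_in_ball]) simp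
  have rem': "(deriv kronecker_rem has_field_derivative deriv (deriv kronecker_rem) 0) (at 0)"
    by (rule holomorphic_derivI[OF holomorphic_deriv_kronecker_rem _ zero_in_ball]) simp
  show "(kronecker_reg has_field_derivative - twisted_eisenstein 2) (at 0)"
    "(kronecker_quot has_field_derivative twisted_eisenstein 3) (at 0)"
    "(kronecker_reg' has_field_derivative 2 * twisted_eisenstein 3) (at 0)"
    unfolding kronecker_reg_def[abs_def] kronecker_quot_def[abs_def] kronecker_reg'_def[abs_def]
    by (rule derivative_eq_intros rem rem' refl | simp)+
qed

lemma deriv_kronecker_fun:
  assumes u: "u \<in> ball 0 (1 / coord_bound) - {0}"
  shows "deriv kronecker_fun u = - (inverse u ^ 2) + kronecker_reg' u"
proof -
  have rem: "(kronecker_rem has_field_derivative deriv kronecker_rem u) (at u)"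
    by (rule holomorphic_derivI[OF holomorphic_kronecker_rem]) (use u in auto)
  have "((\<lambda>u. inverse u + kronecker_reg u) has_field_derivative - (inverse u ^ 2) + kronecker_reg' u) (at u)"
    unfolding kronecker_reg_def kronecker_reg'_def
    by (rule derivative_eq_intros rem refl | use u in \<open>simp add: power2_eq_square\<close>)+
  then have "(kronecker_fun has_field_derivative - (inverse u ^ 2) + kronecker_reg' u) (at u)"
    by (rule has_field_derivative_transform_within_open[where S = "ball 0 (1 / coord_bound) - {0}"])
      (use u kronecker_fun_eq in \<open>auto intro: open_delete\<close>)
  then show ?thesis by (rule DERIV_imp_deriv)
qed

end

text \<open>Each character brings its own direction, because the product may be trivial on both
  \<open>h\<^sub>1\<close> and \<open>h\<^sub>2\<close>.\<close>

lemma twisted_eisenstein_relation: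
  assumes "lattice_character \<tau> \<psi>\<^sub>1 h\<^sub>1" "lattice_character \<tau> \<psi>\<^sub>2 h\<^sub>2"
    and "lattice_character \<tau> \<psi>\<^sub>3 h\<^sub>3" and \<psi>\<^sub>3: "\<And>w. w \<in> period_lattice \<tau> \<Longrightarrow> \<psi>\<^sub>3 w = \<psi>\<^sub>1 w * \<psi>\<^sub>2 w"
  defines "e\<^sub>1 \<equiv> lattice_character.twisted_eisenstein \<tau> \<psi>\<^sub>1 h\<^sub>1"
    and "e\<^sub>2 \<equiv> lattice_character.twisted_eisenstein \<tau> \<psi>\<^sub>2 h\<^sub>2"
    and "e\<^sub>3 \<equiv> lattice_character.twisted_eisenstein \<tau> \<psi>\<^sub>3 h\<^sub>3"
  shows "e\<^sub>1 3 + e\<^sub>2 3 - e\<^sub>1 1 * e\<^sub>2 2 - e\<^sub>1 2 * e\<^sub>2 1 + 2 * e\<^sub>3 3 + (e\<^sub>1 1 + e\<^sub>2 1) * e\<^sub>3 2 = 0"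
proof -
  interpret A: lattice_character \<tau> \<psi>\<^sub>1 h\<^sub>1 by fact
  interpret B: lattice_character \<tau> \<psi>\<^sub>2 h\<^sub>2 by fact
  interpret C: lattice_character \<tau> \<psi>\<^sub>3 h\<^sub>3 by fact
  let ?B = "ball 0 (1 / A.coord_bound) :: complex set"
  define a where "a = e\<^sub>1 1 + e\<^sub>2 1"
  define G where "G = (\<lambda>u. A.kronecker_fun u * B.kronecker_fun u
                        + deriv C.kronecker_fun u - a * C.kronecker_fun u)"
  \<comment> \<open>\<open>G\<close> on the punctured disc after cancellation: the double poles have
    opposite signs, and by the choice of \<open>a\<close> the factor of \<open>inverse u\<close> is
    u times the sum of the two quotients.\<close>
  define g where "g = (\<lambda>u. A.kronecker_quot u + B.kronecker_quot u
      + A.kronecker_reg u * B.kronecker_reg u + C.kronecker_reg' u - a * C.kronecker_reg u)"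
  have g0: "g u = 0" if "u \<in> ?B" for u
  proof (rule C.quasi_periodic_eq_0[of G g, OF _ _ _ _ that])
    have "open (- A.L)" using A.closed_L by (simp add: open_Compl)
    then show "G holomorphic_on - A.L"
      unfolding G_def
      by (intro holomorphic_intros holomorphic_deriv A.holomorphic_kronecker_fun
          B.holomorphic_kronecker_fun C.holomorphic_kronecker_fun)
    show "G (u + v) = G u / \<psi>\<^sub>3 v" if "u \<notin> A.L" "v \<in> A.L" for u v
      using that A.psi_nonzero[of v] B.psi_nonzero[of v]
      by (simp add: G_def A.kronecker_fun_shift B.kronecker_fun_shift C.kronecker_fun_shift
          C.deriv_kronecker_fun_shift \<psi>\<^sub>3 field_simps)
    show "g holomorphic_on ?B"
      unfolding g_def
      by (intro holomorphic_intros A.holomorphic_kronecker_parts B.holomorphic_kronecker_parts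
          C.holomorphic_kronecker_parts)
    show "G u = g u" if u: "u \<in> ?B - {0}" for u
    proof -
      have "u \<noteq> 0" using u by simp
      have "G u = (inverse u + A.kronecker_reg u) * (inverse u + B.kronecker_reg u)
          + (- (inverse u ^ 2) + C.kronecker_reg' u) - a * (inverse u + C.kronecker_reg u)"
        by (simp only: G_def A.kronecker_fun_eq[OF u] B.kronecker_fun_eq[OF u]
            C.kronecker_fun_eq[OF u] C.deriv_kronecker_fun[OF u])
      also have "\<dots> = inverse u * (A.kronecker_reg u + B.kronecker_reg u - a)
          + A.kronecker_reg u * B.kronecker_reg u + C.kronecker_reg' u - a * C.kronecker_reg u"
        by (simp add: algebra_simps power2_eq_square)
      also have "A.kronecker_reg u + B.kronecker_reg u - a = u * (A.kronecker_quot u + B.kronecker_quot u)"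
        by (simp add: A.kronecker_reg_eq B.kronecker_reg_eq a_def e\<^sub>1_def e\<^sub>2_def algebra_simps)
      finally show ?thesis
        using \<open>u \<noteq> 0\<close> by (simp add: g_def)
    qed
  qed
  \<comment> \<open>The derivative of \<open>g\<close> at 0, that is, the coefficient at u; it is 0
    because \<open>g\<close> vanishes near 0.\<close>
  let ?d = "e\<^sub>1 3 + e\<^sub>2 3 + (- e\<^sub>1 2 * e\<^sub>2 1 + - e\<^sub>2 2 * e\<^sub>1 1) + 2 * e\<^sub>3 3 - a * (- e\<^sub>3 2)"
  have "(g has_field_derivative ?d) (at 0)"
    unfolding g_def
    by (rule derivative_eq_intros A.kronecker_parts_deriv_0 B.kronecker_parts_deriv_0
        C.kronecker_parts_deriv_0 refl
        | simp add: A.kronecker_parts_0 B.kronecker_parts_0 C.kronecker_parts_0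
            e\<^sub>1_def e\<^sub>2_def e\<^sub>3_def)+
  moreover have "(g has_field_derivative 0) (at 0)"
    by (rule has_field_derivative_transform_within_open[of "\<lambda>_. 0" 0 0 ?B])
      (use g0 A.zero_in_ball in auto)
  ultimately have "?d = 0"
    by (rule DERIV_unique)
  then show ?thesis
    by (simp add: a_def algebra_simps)
qed

section \<open>Characters attached to points of the torus\<close>

lemma lattice_char_add: "lattice_char \<tau> (x + y) w = lattice_char \<tau> x w * lattice_char \<tau> y w"
  by (simp add: lattice_char_def algebra_simps add_divide_distrib diff_divide_distrib flip: exp_add)

text \<open>The exponent is purely imaginary, so the values are unitary. At the generators 1 and
  \<tau> they are exp(-2\<pi>i x1) and exp(2\<pi>i x2), so as soon as one coordinate is not an
  integer, 1 or \<tau> serves as \<open>h\<close>.\<close>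

lemma lattice_character_lattice_char:
  fixes x1 x2 :: real
  assumes \<tau>: "Im \<tau> > 0" and x: "\<not> (x1 \<in> \<int> \<and> x2 \<in> \<int>)"
  obtains h where "lattice_character \<tau> (lattice_char \<tau> (of_real x1 * \<tau> + of_real x2)) h"
proof -
  define x where "x = of_real x1 * \<tau> + of_real x2"
  interpret lattice \<tau> by unfold_locales fact
  have norm: "norm (lattice_char \<tau> x w) = 1" for w
  proof -
    have "Re ((w * cnj x - cnj w * x) / of_real (Im \<tau> / pi)) = 0"
      by (simp only: Re_divide_of_real) simp
    then show ?thesis by (simp add: lattice_char_def)
  qed
  have add: "lattice_char \<tau> x (v + w) = lattice_char \<tau> x v * lattice_char \<tau> x w" for v w
    by (simp add: lattice_char_def algebra_simps add_divide_distrib diff_divide_distrib flip: exp_add)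
  have Ints: "t \<in> \<int>" if t: "exp (2 * pi * \<i> * of_real t) = 1" for t
  proof -
    obtain n :: int where "2 * pi * t = of_int (2 * n) * pi"
      using t by (auto simp: exp_eq_1)
    then have "t = of_int n" by simp
    then show ?thesis by simp
  qed
  have "lattice_char \<tau> x 1 = exp (2 * pi * \<i> * of_real (- x1))"
  proof -
    have "cnj x - x = - 2 * of_real (x1 * Im \<tau>) * \<i>"
      by (simp add: x_def complex_eq_iff)
    then show ?thesis
      unfolding lattice_char_def using \<tau> by (simp only: of_real_mult mult_1 complex_cnj_one) (simp add: field_simps)
  qed
  moreover have "lattice_char \<tau> x \<tau> = exp (2 * pi * \<i> * of_real x2)"
  proof -
    have "\<tau> * cnj x - cnj \<tau> * x = 2 * of_real (x2 * Im \<tau>) * \<i>"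
      by (simp add: x_def complex_eq_iff algebra_simps)
    then show ?thesis
      unfolding lattice_char_def using \<tau> by (simp only: of_real_mult mult_1 complex_cnj_one) (simp add: field_simps)
  qed
  ultimately obtain h where "h \<in> L" "lattice_char \<tau> x h \<noteq> 1"
    using Ints[of "- x1"] Ints[of x2] x one_in_L tau_in_L by (metis Ints_minus minus_minus)
  then have "lattice_character \<tau> (lattice_char \<tau> x) h"
    by unfold_locales (auto simp: norm add)
  then show ?thesis
    using that by (simp add: x_def)
qed

lemma abs_real_mod_int_eq_0_iff: "abs_real_mod_int t = 0 \<longleftrightarrow> t \<in> \<int>"
  by (simp add: zero_real_mod_int_def real_mod_int.abs_eq_iff)

lemma eisenstein_E_abs:
  "eisenstein_E k (abs_real_mod_int x1, abs_real_mod_int x2) \<tau> =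
     - (fact (k - 1) / (- 2 * of_real pi * \<i>) ^ k
        * kronecker_K k (of_real x1 * \<tau> + of_real x2) (of_nat k) \<tau>)"
  by (simp add: eisenstein_E_def eisenstein_E_aux.abs_eq)

theorem theorem6p1:
  fixes x y z :: "real_mod_int \<times> real_mod_int" and \<tau> :: complex
  assumes "x \<noteq> 0" and "y \<noteq> 0" and "z \<noteq> 0"
    and "x + y + z = 0"
    and "Im \<tau> > 0"
  shows "eisenstein_E 1 z \<tau> * eisenstein_E 2 y \<tau> - eisenstein_E 1 y \<tau> * eisenstein_E 2 x \<tau>
       - eisenstein_E 1 z \<tau> * eisenstein_E 2 x \<tau> + eisenstein_E 1 y \<tau> * eisenstein_E 2 z \<tau>
     = eisenstein_E 3 x \<tau> - 1 / 2 * eisenstein_E 3 y \<tau> - 1 / 2 * eisenstein_E 3 z \<tau>"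
proof -
  obtain y1 y2 where y: "y = (abs_real_mod_int y1, abs_real_mod_int y2)"
    by (metis Quotient3_abs_rep Quotient3_real_mod_int surj_pair)
  obtain z1 z2 where z: "z = (abs_real_mod_int z1, abs_real_mod_int z2)"
    by (metis Quotient3_abs_rep Quotient3_real_mod_int surj_pair)
  have "x = - (y + z)"
    using assms(4) unfolding eq_neg_iff_add_eq_0 by (simp only: add.assoc)
  \<comment> \<open>Representatives are chosen for y and z only; x gets the exact negative of their
    sum, so its point is -(py + pz) without integer corrections.\<close>
  then have x: "x = (abs_real_mod_int (- (y1 + z1)), abs_real_mod_int (- (y2 + z2)))"
    by (simp add: y z plus_real_mod_int.abs_eq uminus_real_mod_int.abs_eq)
  have nz: "\<not> (y1 \<in> \<int> \<and> y2 \<in> \<int>)" "\<not> (z1 \<in> \<int> \<and> z2 \<in> \<int>)"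
    "\<not> (y1 + z1 \<in> \<int> \<and> y2 + z2 \<in> \<int>)"
    using assms(1-3) unfolding x y z
    by (auto simp: zero_prod_def abs_real_mod_int_eq_0_iff simp del: minus_add_distrib)
  define py where "py = of_real y1 * \<tau> + of_real y2"
  define pz where "pz = of_real z1 * \<tau> + of_real z2"
  have sum: "of_real (y1 + z1) * \<tau> + of_real (y2 + z2) = py + pz"
    by (simp add: py_def pz_def algebra_simps)
  obtain hy where A: "lattice_character \<tau> (lattice_char \<tau> py) hy"
    using lattice_character_lattice_char[OF assms(5) nz(1)] unfolding py_def by blast
  obtain hz where B: "lattice_character \<tau> (lattice_char \<tau> pz) hz"
    using lattice_character_lattice_char[OF assms(5) nz(2)] unfolding pz_def by blast
  obtain hs where C: "lattice_character \<tau> (lattice_char \<tau> (py + pz)) hs"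
    using lattice_character_lattice_char[OF assms(5) nz(3)] unfolding sum by blast
  interpret A: lattice_character \<tau> "lattice_char \<tau> py" hy by fact
  interpret B: lattice_character \<tau> "lattice_char \<tau> pz" hz by fact
  interpret C: lattice_character \<tau> "lattice_char \<tau> (py + pz)" hs by fact
  let ?c = "2 * of_real pi * \<i> :: complex"
  have E: "eisenstein_E k y \<tau> = - (fact (k - 1) / (- ?c) ^ k * A.twisted_eisenstein k)"
    "eisenstein_E k z \<tau> = - (fact (k - 1) / (- ?c) ^ k * B.twisted_eisenstein k)"
    "eisenstein_E k x \<tau> = - (fact (k - 1) / (- ?c) ^ k * ((- 1) ^ k * C.twisted_eisenstein k))"
    if "k > 0" for k
  proof -
    have "of_real (- (y1 + z1)) * \<tau> + of_real (- (y2 + z2)) = - (py + pz)"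
      by (simp add: py_def pz_def algebra_simps)
    then show "eisenstein_E k x \<tau> = - (fact (k - 1) / (- ?c) ^ k * ((- 1) ^ k * C.twisted_eisenstein k))"
      unfolding x eisenstein_E_abs
      using C.kronecker_K_uminus[OF refl] C.kronecker_K_eq_twisted_eisenstein[OF refl that] by simp
    show "eisenstein_E k y \<tau> = - (fact (k - 1) / (- ?c) ^ k * A.twisted_eisenstein k)"
      "eisenstein_E k z \<tau> = - (fact (k - 1) / (- ?c) ^ k * B.twisted_eisenstein k)"
      unfolding y z eisenstein_E_abs py_def[symmetric] pz_def[symmetric]
      using A.kronecker_K_eq_twisted_eisenstein[OF refl that]
        B.kronecker_K_eq_twisted_eisenstein[OF refl that] by simp_all
  qed
  have rel: "A.twisted_eisenstein 3 + B.twisted_eisenstein 3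
      - A.twisted_eisenstein 1 * B.twisted_eisenstein 2 - A.twisted_eisenstein 2 * B.twisted_eisenstein 1
      + 2 * C.twisted_eisenstein 3
      + (A.twisted_eisenstein 1 + B.twisted_eisenstein 1) * C.twisted_eisenstein 2 = 0"
    by (rule twisted_eisenstein_relation[OF A B C]) (simp add: lattice_char_add)
  \<comment> \<open>Here d stands for -2\<pi>i. Every term carries d^(-3); the factor 2! in weight 3
    cancels the two halves and leaves the coefficient 2 at \<open>c3\<close>, and the parity for x =
    -(y + z) keeps \<open>c2\<close> but reverses the sign of \<open>c3\<close>.\<close>
  have alg: "(- (1 / d * b1)) * (- (1 / d ^ 2 * a2)) - (- (1 / d * a1)) * (- (1 / d ^ 2 * c2))
      - (- (1 / d * b1)) * (- (1 / d ^ 2 * c2)) + (- (1 / d * a1)) * (- (1 / d ^ 2 * b2))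
      = - (2 / d ^ 3 * (- c3)) - 1 / 2 * (- (2 / d ^ 3 * a3)) - 1 / 2 * (- (2 / d ^ 3 * b3))"
    if "a3 + b3 - a1 * b2 - a2 * b1 + 2 * c3 + (a1 + b1) * c2 = 0"
    for a1 a2 a3 b1 b2 b3 c2 c3 d :: complex
  proof -
    define i where "i = 1 / d"
    have d: "1 / d ^ 2 = i ^ 2" "2 / d ^ 3 = 2 * i ^ 3"
      by (simp_all add: i_def power_divide)
    show ?thesis
      using that unfolding d i_def[symmetric] by simp algebra
  qed
  show ?thesis
    using alg[OF rel, of "- ?c"] E[of 1] E[of 2] E[of 3] by (simp add: fact_numeral)
qed

end
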